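(* Let $P$ be a spindle of dimension $d$, with $n$ facets and length $l$. Then there is another spindle $P'$ of dimension $n-d$, with $2n-2d$ facets and with length at least $l+n-2d$. In particular, if $l>d$ then $P'$ violates the $d$-step conjecture (i.e. $P'$ is a polytope of dimension $D=n-d$ with $2D$ facets whose combinatorial diameter is greater than $D$), hence also the Hirsch conjecture.
   Context: Polytopes are convex and bounded; a $d$-polytope is a polytope of dimension $d$. The graph of a polytope consists of its vertices and edges, and graph distance is the minimum number of edges in a path. The combinatorial diameter of a polytope is the diameter of its graph. A $d$-spindle is a $d$-polytope $P$ with two distinguished vertices $u$ and $v$ such that every facet of $P$ contains exactly one of them. The length of a spindle is the graph distance between $u$ and $v$. The Hirsch conjecture states that every $d$-polytope with $n$ facets has combinatorial diameter at most $n-d$; the $d$-step conjecture is the case $n=2d$. *)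

theory Defs
  imports "HOL-Analysis.Polytope" "HOL-Library.Extended_Nat"
begin

definition polytope_vertices :: "'a::euclidean_space set \<Rightarrow> 'a set" where
  "polytope_vertices P = {x. x extreme_point_of P}"

definition polytope_facets :: "'a::euclidean_space set \<Rightarrow> 'a set set" where
  "polytope_facets P = {F. F facet_of P}"

text \<open>The graph of a polytope: two distinct vertices are adjacent iff some edge
  (one-dimensional face) contains both.\<close>

definition polytope_adj :: "'a::euclidean_space set \<Rightarrow> 'a \<Rightarrow> 'a \<Rightarrow> bool" where
  "polytope_adj P x y \<longleftrightarrow>
     x \<in> polytope_vertices P \<and> y \<in> polytope_vertices P \<and> x \<noteq> y \<and>
     (\<exists>e. e edge_of P \<and> x \<in> e \<and> y \<in> e)"

definition polytope_path :: "'a::euclidean_space set \<Rightarrow> 'a \<Rightarrow> 'a \<Rightarrow> 'a list \<Rightarrow> bool" where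
  "polytope_path P x y xs \<longleftrightarrow>
     xs \<noteq> [] \<and> hd xs = x \<and> last xs = y \<and> set xs \<subseteq> polytope_vertices P \<and>
     distinct xs \<and> successively (polytope_adj P) xs"

text \<open>A path with vertex list \<open>xs\<close> has \<open>length xs - 1\<close> edges. Distances take values in
  \<open>enat\<close>, so that the distance is \<open>\<infinity>\<close> where no path exists (which does not happen between
  vertices of a polytope).\<close>

definition graph_dist :: "'a::euclidean_space set \<Rightarrow> 'a \<Rightarrow> 'a \<Rightarrow> enat" where
  "graph_dist P x y = (INF xs\<in>{xs. polytope_path P x y xs}. enat (length xs - 1))"

definition combinatorial_diameter :: "'a::euclidean_space set \<Rightarrow> enat" where
  "combinatorial_diameter P =
     (SUP x\<in>polytope_vertices P. SUP y\<in>polytope_vertices P. graph_dist P x y)"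

definition spindle :: "'a::euclidean_space set \<Rightarrow> 'a \<Rightarrow> 'a \<Rightarrow> bool" where
  "spindle P u v \<longleftrightarrow>
     polytope P \<and> u \<in> polytope_vertices P \<and> v \<in> polytope_vertices P \<and> u \<noteq> v \<and>
     (\<forall>F\<in>polytope_facets P. (u \<in> F) \<noteq> (v \<in> F))"

definition spindle_length :: "'a::euclidean_space set \<Rightarrow> 'a \<Rightarrow> 'a \<Rightarrow> enat" where
  "spindle_length P u v = graph_dist P u v"

text \<open>The two conjectures, for the polytopes (of any dimension) lying in the Euclidean space
  \<open>'a\<close>; the unrestricted conjectures assert these for every \<open>'a\<close>, so failure for a
  single \<open>'a\<close> refutes them. The subtraction \<open>n - d\<close> on \<open>nat\<close> does not truncate, since a
  nonempty polytope of dimension \<open>d\<close> has at least \<open>d\<close> facets.\<close>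

definition hirsch_conjecture :: "'a::euclidean_space itself \<Rightarrow> bool" where
  "hirsch_conjecture _ \<longleftrightarrow>
     (\<forall>(P :: 'a set) d n. polytope P \<and> aff_dim P = int d \<and> card (polytope_facets P) = n
        \<longrightarrow> combinatorial_diameter P \<le> enat (n - d))"

definition d_step_conjecture :: "'a::euclidean_space itself \<Rightarrow> bool" where
  "d_step_conjecture _ \<longleftrightarrow>
     (\<forall>(P :: 'a set) d. polytope P \<and> aff_dim P = int d \<and> card (polytope_facets P) = 2 * d
        \<longrightarrow> combinatorial_diameter P \<le> enat d)"

end

theory Submission imports Defs "HOL-Analysis.Homotopy" begin

text \<open>If \<open>n > 2 d\<close>, then one apex, say \<open>u\<close>, lies on more than \<open>d\<close> facets. Take the wedge
  \<open>{(x, y). x \<in> P, \<bar>y\<bar> \<le> c x}\<close> of \<open>P\<close> over a facet through \<open>v\<close>, where \<open>c\<close> is the slack of that facet.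
  The fibre over \<open>u\<close> is an edge, which becomes a single vertex \<open>(u, 0)\<close> when a facet through \<open>u\<close> whose
  normal is redundant at \<open>u\<close> is replaced by a slightly tilted one. The result is a spindle of dimension
  \<open>d + 1\<close> with \<open>n + 1\<close> facets. Sending its vertices to suitable vertices of \<open>P\<close> contracts paths, and
  the first step from \<open>(u, 0)\<close> is always contracted to \<open>u\<close>, so the length grows by at least one.
  Iterate \<open>n - 2 d\<close> times.\<close>

text \<open>Lengths are bounded from below, so an arbitrary path of the new polytope must be pushed
  down to P. Two things stand in the way: vertices on the tilted facet need not project to vertices
  of P, and without constraint i the projection may stick out of P beyond facet i. A small tilt
  controls both. It leaves the fibres over vertices of P off facet i untouched, and it confines
  everything beyond facet i to a ball around u that meets no facet missing u; that whole region is
  sent to u. The redundancy of the normal enters twice: the remaining normals at u still determine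
  u, and they bound the norm on the region beyond facet i. P may be degenerate, so adjacency in P is
  derived from dimension counts for direction spaces of faces. A wedge raises n and d by one each,
  so the excess n - 2 d drops by one in every round. As long as it is positive, some apex lies on
  more than d facets, because every facet contains exactly one apex.\<close>

section \<open>Walks, contractions and graph distance\<close>

text \<open>Images of paths under a contraction may revisit vertices, whereas
  \<open>polytope_path\<close> asks for distinct ones. When the new head already occurs in the path,
  the part before that occurrence is dropped.\<close>

lemma path_of_walk:
  assumes "zs \<noteq> []" "set zs \<subseteq> polytope_vertices P"
    and "successively (\<lambda>x y. x = y \<or> polytope_adj P x y) zs"
  shows "\<exists>xs. polytope_path P (hd zs) (last zs) xs \<and> length xs \<le> length zs"
  using assms
proof (induction zs)
  case Nil
  then show ?case by simp
next
  case (Cons x zs)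
  show ?case
  proof (cases "zs = []")
    case True
    then show ?thesis
      using Cons.prems by (intro exI[of _ "[x]"]) (auto simp: polytope_path_def)
  next
    case False
    with Cons obtain xs where xs: "polytope_path P (hd zs) (last zs) xs" "length xs \<le> length zs"
      by (auto simp: successively_Cons)
    have step: "x = hd zs \<or> polytope_adj P x (hd zs)"
      using Cons.prems(3) False by (auto simp: successively_Cons)
    show ?thesis
    proof (cases "x \<in> set xs")
      case True
      then obtain ys ws where "xs = ys @ x # ws"
        by (meson split_list)
      then have "polytope_path P x (last zs) (x # ws)"
        using xs(1) by (auto simp: polytope_path_def successively_append_iff)
      then show ?thesis
        using False xs(2) \<open>xs = ys @ x # ws\<close>
        by (intro exI[of _ "x # ws"]) auto
    next
      case notin: False
      then have "polytope_adj P x (hd zs)"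
        using step xs(1) by (metis hd_in_set polytope_path_def)
      then have "polytope_path P x (last zs) (x # xs)"
        using xs(1) notin Cons.prems(2) False
        by (auto simp: polytope_path_def successively_Cons)
      then show ?thesis
        using False xs(2) by (intro exI[of _ "x # xs"]) auto
    qed
  qed
qed

lemma graph_dist_le_path:
  assumes "polytope_path P x y xs" "length xs \<le> m"
  shows "graph_dist P x y \<le> enat (m - 1)"
proof -
  have "graph_dist P x y \<le> enat (length xs - 1)"
    unfolding graph_dist_def using assms(1) by (intro INF_lower) simp
  also have "\<dots> \<le> enat (m - 1)"
    using assms(2) by auto
  finally show ?thesis .
qed

lemma graph_dist_le_image_path:
  assumes path: "polytope_path Q x y xs"
    and vert: "\<And>z. z \<in> polytope_vertices Q \<Longrightarrow> \<phi> z \<in> polytope_vertices P"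
    and adj: "\<And>z z'. polytope_adj Q z z' \<Longrightarrow> \<phi> z = \<phi> z' \<or> polytope_adj P (\<phi> z) (\<phi> z')"
  shows "graph_dist P (\<phi> x) (\<phi> y) \<le> enat (length xs - 1)"
proof -
  have xs: "xs \<noteq> []" "hd xs = x" "last xs = y" "set xs \<subseteq> polytope_vertices Q"
    "successively (polytope_adj Q) xs"
    using path by (auto simp: polytope_path_def)
  have "successively (\<lambda>z z'. z = z' \<or> polytope_adj P z z') (map \<phi> xs)"
    unfolding successively_map by (rule successively_mono[OF xs(5)]) (use adj in auto)
  moreover have "set (map \<phi> xs) \<subseteq> polytope_vertices P"
    using xs(4) vert by auto
  ultimately obtain ys where "polytope_path P (hd (map \<phi> xs)) (last (map \<phi> xs)) ys"
      "length ys \<le> length (map \<phi> xs)"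
    using path_of_walk[of "map \<phi> xs" P] xs(1) by auto
  then show ?thesis
    using graph_dist_le_path[of P "\<phi> x" "\<phi> y" ys "length xs"] xs
    by (simp add: hd_map last_map)
qed

lemma graph_dist_image_le:
  assumes "\<And>z. z \<in> polytope_vertices Q \<Longrightarrow> \<phi> z \<in> polytope_vertices P"
    and "\<And>z z'. polytope_adj Q z z' \<Longrightarrow> \<phi> z = \<phi> z' \<or> polytope_adj P (\<phi> z) (\<phi> z')"
  shows "graph_dist P (\<phi> x) (\<phi> y) \<le> graph_dist Q x y"
  unfolding graph_dist_def[of Q] using graph_dist_le_image_path[OF _ assms]
  by (intro INF_greatest) auto

text \<open>The first edge of a path from x is contracted by \<open>\<phi>\<close>, so the rest of
  the path already has an image joining the two image points. The condition
  \<open>x \<noteq> y\<close> guarantees that a first edge exists.\<close>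

lemma graph_dist_image_Suc_le:
  assumes vert: "\<And>z. z \<in> polytope_vertices Q \<Longrightarrow> \<phi> z \<in> polytope_vertices P"
    and adj: "\<And>z z'. polytope_adj Q z z' \<Longrightarrow> \<phi> z = \<phi> z' \<or> polytope_adj P (\<phi> z) (\<phi> z')"
    and first: "\<And>z. polytope_adj Q x z \<Longrightarrow> \<phi> z = \<phi> x"
    and "x \<noteq> y"
  shows "graph_dist P (\<phi> x) (\<phi> y) + 1 \<le> graph_dist Q x y"
  unfolding graph_dist_def[of Q]
proof (intro INF_greatest)
  fix xs assume "xs \<in> {xs. polytope_path Q x y xs}"
  then have path: "polytope_path Q x y xs" by simp
  then obtain z zs where xs: "xs = x # z # zs"
    using \<open>x \<noteq> y\<close> unfolding polytope_path_def
    by (metis last_ConsL list.collapse)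
  have "polytope_path Q z y (z # zs)" "polytope_adj Q x z"
    using path unfolding xs by (auto simp: polytope_path_def)
  then have "graph_dist P (\<phi> x) (\<phi> y) \<le> enat (length zs)"
    using graph_dist_le_image_path[of Q z y "z # zs" \<phi> P, OF _ vert adj] first by simp
  then have "graph_dist P (\<phi> x) (\<phi> y) + 1 \<le> enat (length zs) + 1"
    by (rule add_right_mono)
  then show "graph_dist P (\<phi> x) (\<phi> y) + 1 \<le> enat (length xs - 1)"
    by (simp add: xs one_enat_def)
qed

lemma polytope_adj_commute: "polytope_adj P x y \<longleftrightarrow> polytope_adj P y x"
  by (auto simp: polytope_adj_def)

lemma graph_dist_commute: "graph_dist P x y = graph_dist P y x"
proof -
  have "polytope_path P y x (rev xs)" if "polytope_path P x y xs" for x y xs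
    using that unfolding polytope_path_def
    by (auto simp: hd_rev last_rev polytope_adj_commute)
  then have "graph_dist P x y \<le> graph_dist P y x" for x y
    unfolding graph_dist_def[of P y x]
    by (intro INF_greatest) (metis graph_dist_le_path length_rev mem_Collect_eq order_refl)
  then show ?thesis
    by (simp add: order_antisym)
qed

lemma spindle_commute: "spindle P u v \<longleftrightarrow> spindle P v u"
  by (auto simp: spindle_def)

text \<open>In the applications only an upper bound for the directions in G is available; the two
  distinct points supply the lower bound on the dimension.\<close>

lemma polytope_adjI:
  assumes G: "G face_of P" "x \<in> G" "y \<in> G" "x \<noteq> y"
    and "x \<in> polytope_vertices P" "y \<in> polytope_vertices P"
    and D: "\<And>z. z \<in> G \<Longrightarrow> z - x \<in> D" "dim D \<le> 1"
  shows "polytope_adj P x y"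
proof -
  have "aff_dim G = aff_dim ((\<lambda>z. - x + z) ` G)"
    by (simp only: aff_dim_translation_eq)
  also have "\<dots> = int (dim ((\<lambda>z. - x + z) ` G))"
    using G(2) by (intro aff_dim_zero hull_inc) force
  also have "\<dots> \<le> 1"
  proof -
    have "(\<lambda>z. - x + z) ` G \<subseteq> D" using D(1) by auto
    then have "dim ((\<lambda>z. - x + z) ` G) \<le> 1" using dim_subset D(2) le_trans by blast
    then show ?thesis by simp
  qed
  finally have "aff_dim G \<le> 1" .
  moreover have "1 \<le> aff_dim G"
    using aff_dim_subset[of "{x, y}" G] G by (auto simp: aff_dim_2)
  ultimately have "G edge_of P"
    using G(1) by (simp add: edge_of_def)
  then show ?thesis
    using assms by (auto simp: polytope_adj_def)
qed

subsection \<open>Polyhedra in a subspace\<close>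

text \<open>Finitely many strict inequalities are an open condition at t = 0. The small constants of
  the construction all come from here, sometimes with an artificial index set that merely lists a
  few conditions.\<close>

lemma small_step:
  fixes \<alpha> \<beta> \<gamma> :: "'k \<Rightarrow> real"
  assumes "finite K" "\<And>k. k \<in> K \<Longrightarrow> \<alpha> k < \<gamma> k"
  shows "\<exists>t>0. t < 1 \<and> (\<forall>k\<in>K. \<alpha> k + t * \<beta> k < \<gamma> k)"
proof -
  have "\<forall>\<^sub>F t in at_right 0. \<forall>k\<in>K. \<alpha> k + t * \<beta> k < \<gamma> k"
  proof (intro eventually_ball_finite ballI assms(1))
    fix k assume "k \<in> K"
    have "((\<lambda>t. \<alpha> k + t * \<beta> k) \<longlongrightarrow> \<alpha> k + 0 * \<beta> k) (at_right 0)"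
      by (intro tendsto_intros)
    then show "\<forall>\<^sub>F t in at_right 0. \<alpha> k + t * \<beta> k < \<gamma> k"
      using assms(2)[OF \<open>k \<in> K\<close>] by (intro order_tendstoD(2)[of _ "\<alpha> k"]) simp_all
  qed
  moreover have "\<forall>\<^sub>F t in at_right (0::real). t < 1"
    by (rule eventually_at_right_real[of 0 1, THEN eventually_mono]) auto
  ultimately have "\<forall>\<^sub>F t in at_right (0::real). t > 0 \<and> t < 1 \<and> (\<forall>k\<in>K. \<alpha> k + t * \<beta> k < \<gamma> k)"
    by (intro eventually_conj) (auto simp: eventually_at_right_less)
  then show ?thesis
    using eventually_happens trivial_limit_at_right_real by blast
qed

text \<open>A is a linear subspace because an apex sits at 0, and it may be proper because the
  dimension grows within one fixed type. The labels in K allow the wedge to change normals while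
  keeping track of the facets.\<close>

definition cell :: "'a::euclidean_space set \<Rightarrow> 'k set \<Rightarrow> ('k \<Rightarrow> 'a) \<Rightarrow> ('k \<Rightarrow> real) \<Rightarrow> 'a set" where
  "cell A K a b = {x \<in> A. \<forall>k\<in>K. a k \<bullet> x \<le> b k}"

lemma cell_eq_Int: "cell A K a b = A \<inter> (\<Inter>k\<in>K. {x. a k \<bullet> x \<le> b k})"
  by (auto simp: cell_def)

lemma convex_cell: "subspace A \<Longrightarrow> convex (cell A K a b)"
  unfolding cell_eq_Int
  by (intro convex_Int convex_INT convex_halfspace_le) (rule subspace_imp_convex)

lemma polyhedron_cell:
  assumes "subspace A" "finite K"
  shows "polyhedron (cell A K a b)"
  unfolding cell_eq_Int
proof (rule polyhedron_Int)
  show "polyhedron A"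
    using assms(1) by (simp add: affine_imp_polyhedron subspace_imp_affine)
  show "polyhedron (\<Inter>k\<in>K. {x. a k \<bullet> x \<le> b k})"
    using assms(2) by (intro polyhedron_Inter) (auto simp: polyhedron_halfspace_le)
qed

lemma face_of_cell:
  assumes "subspace A" "T \<subseteq> K"
  shows "{x \<in> cell A K a b. \<forall>k\<in>T. a k \<bullet> x = b k} face_of cell A K a b"
proof (cases "T = {}")
  case True
  then show ?thesis
    using face_of_refl[OF convex_cell[OF assms(1)], of K a b] by simp
next
  case False
  have "cell A K a b \<inter> {x. a k \<bullet> x = b k} face_of cell A K a b" if "k \<in> T" for k
    using that assms(2)
    by (intro face_of_Int_supporting_hyperplane_le convex_cell[OF assms(1)]) (auto simp: cell_def)
  then have "(\<Inter>k\<in>T. cell A K a b \<inter> {x. a k \<bullet> x = b k}) face_of cell A K a b"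
    using False by (intro face_of_Inter) auto
  also have "(\<Inter>k\<in>T. cell A K a b \<inter> {x. a k \<bullet> x = b k}) = {x \<in> cell A K a b. \<forall>k\<in>T. a k \<bullet> x = b k}"
    using False by auto
  finally show ?thesis .
qed

text \<open>Along p the constraints tight at m stay tight, and the others have slack at m. The
  segment is two-sided, which is what arguments about extreme points and faces require.\<close>

lemma cell_move:
  assumes A: "subspace A" and K: "finite K" and m: "m \<in> cell A K a b" and p: "p \<in> A"
    and tight: "\<And>k. k \<in> K \<Longrightarrow> a k \<bullet> m = b k \<Longrightarrow> a k \<bullet> p = 0"
  shows "\<exists>t>0. m + t *\<^sub>R p \<in> cell A K a b \<and> m - t *\<^sub>R p \<in> cell A K a b"
proof -
  let ?L = "{k \<in> K. a k \<bullet> m \<noteq> b k}"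
  obtain t where t: "t > 0" "\<And>k. k \<in> ?L \<Longrightarrow> a k \<bullet> m + t * \<bar>a k \<bullet> p\<bar> < b k"
    using small_step[of ?L "\<lambda>k. a k \<bullet> m" b "\<lambda>k. \<bar>a k \<bullet> p\<bar>"] K m
    by (force simp: cell_def less_le)
  have *: "a k \<bullet> m + s * (a k \<bullet> p) \<le> b k" if "k \<in> K" "s = t \<or> s = - t" for k s
  proof (cases "a k \<bullet> m = b k")
    case True
    then show ?thesis using tight[OF that(1)] by simp
  next
    case False
    then have "a k \<bullet> m + t * \<bar>a k \<bullet> p\<bar> < b k" using t(2) that(1) by simp
    moreover have "s * (a k \<bullet> p) \<le> t * \<bar>a k \<bullet> p\<bar>"
      using abs_ge_self[of "s * (a k \<bullet> p)"] that(2) t(1) by (auto simp: abs_mult)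
    ultimately show ?thesis by linarith
  qed
  have "m + t *\<^sub>R p \<in> A" "m - t *\<^sub>R p \<in> A"
    using m p A by (auto simp: cell_def subspace_add subspace_diff subspace_scale)
  then show ?thesis
    using t(1) *[of _ t] *[of _ "- t"]
    by (intro exI[of _ t]) (auto simp: cell_def inner_add_right inner_diff_right)
qed

text \<open>Otherwise \<open>x - w\<close> would be a direction as in \<open>cell_move\<close>, and
  w the midpoint of a segment in the cell.\<close>

lemma vertex_cell_unique:
  assumes "subspace A" "finite K" "w extreme_point_of cell A K a b" "x \<in> A"
    and "\<And>k. k \<in> K \<Longrightarrow> a k \<bullet> w = b k \<Longrightarrow> a k \<bullet> x = b k"
  shows "x = w"
proof (rule ccontr)
  assume "x \<noteq> w"
  have w: "w \<in> cell A K a b"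
    using assms(3) by (simp add: extreme_point_of_def)
  then have "x - w \<in> A"
    using assms(1,4) by (auto simp: cell_def subspace_diff)
  then obtain t where "t > 0" "w + t *\<^sub>R (x - w) \<in> cell A K a b" "w - t *\<^sub>R (x - w) \<in> cell A K a b"
    using cell_move[OF assms(1,2) w, of "x - w"] assms(5) by (auto simp: inner_diff_right)
  moreover have "w \<in> open_segment (w - t *\<^sub>R (x - w)) (w + t *\<^sub>R (x - w))"
  proof -
    have "w = midpoint (w - t *\<^sub>R (x - w)) (w + t *\<^sub>R (x - w))"
      by (simp add: midpoint_def scaleR_2[symmetric])
    then show ?thesis
      using \<open>t > 0\<close> \<open>x \<noteq> w\<close> midpoint_in_open_segment
      by (metis eq_iff_diff_eq_0 diff_add_cancel add_diff_cancel_left' midpoint_eq_endpoint(1)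
          less_irrefl scaleR_eq_0_iff diff_eq_diff_eq)
  qed
  ultimately show False
    using assms(3) by (auto simp: extreme_point_of_def)
qed

lemma extreme_point_cellI:
  assumes "subspace A" "T \<subseteq> K" "w \<in> cell A K a b" "\<And>k. k \<in> T \<Longrightarrow> a k \<bullet> w = b k"
    and "\<And>x. x \<in> A \<Longrightarrow> (\<And>k. k \<in> T \<Longrightarrow> a k \<bullet> x = b k) \<Longrightarrow> x = w"
  shows "w extreme_point_of cell A K a b"
proof -
  have "{x \<in> cell A K a b. \<forall>k\<in>T. a k \<bullet> x = b k} = {w}"
    using assms(3,4) by (intro equalityI subsetI) (simp_all add: cell_def assms(5))
  then show ?thesis
    using face_of_cell[OF assms(1,2), of a b] by (simp add: face_of_singleton)
qed

text \<open>The constraints tight at the midpoint of z and z' are those tight at both ends. So p is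
  a two-sided feasible direction there, the face property pulls the segment into E, and an edge is
  collinear.\<close>

lemma edge_cell_direction:
  assumes A: "subspace A" and K: "finite K" and E: "E edge_of cell A K a b"
    and z: "z \<in> E" "z' \<in> E" "z \<noteq> z'" and p: "p \<in> A"
    and tight: "\<And>k. k \<in> K \<Longrightarrow> a k \<bullet> z = b k \<Longrightarrow> a k \<bullet> z' = b k \<Longrightarrow> a k \<bullet> p = 0"
  shows "\<exists>c. p = c *\<^sub>R (z' - z)"
proof (cases "p = 0")
  case True
  then show ?thesis by (intro exI[of _ 0]) simp
next
  case False
  let ?m = "midpoint z z'"
  have E': "E face_of cell A K a b" "aff_dim E = 1"
    using E by (auto simp: edge_of_def)
  have mE: "?m \<in> E"
    using face_of_imp_convex[OF E'(1)] z closed_segment_subset midpoint_in_closed_segment by blast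
  have sub: "E \<subseteq> cell A K a b"
    using E'(1) face_of_imp_subset by blast
  have "a k \<bullet> p = 0" if k: "k \<in> K" "a k \<bullet> ?m = b k" for k
  proof (rule tight[OF k(1)])
    have "a k \<bullet> z \<le> b k" "a k \<bullet> z' \<le> b k"
      using sub z k(1) by (auto simp: cell_def)
    moreover have "a k \<bullet> z + a k \<bullet> z' = 2 * b k"
      using k(2) by (simp add: midpoint_def inner_add_right)
    ultimately show "a k \<bullet> z = b k" "a k \<bullet> z' = b k" by linarith+
  qed
  then obtain t where t: "t > 0" "?m + t *\<^sub>R p \<in> cell A K a b" "?m - t *\<^sub>R p \<in> cell A K a b"
    using cell_move[OF A K _ p, of ?m a b] mE sub by blast
  have "?m = midpoint (?m - t *\<^sub>R p) (?m + t *\<^sub>R p)"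
    by (simp add: midpoint_def[of "_ - _"] scaleR_2[symmetric])
  moreover have "?m - t *\<^sub>R p \<noteq> ?m + t *\<^sub>R p"
  proof
    assume "?m - t *\<^sub>R p = ?m + t *\<^sub>R p"
    moreover have "(t + t) *\<^sub>R p = (?m + t *\<^sub>R p) - (?m - t *\<^sub>R p)"
      unfolding scaleR_add_left by simp
    ultimately have "(t + t) *\<^sub>R p = 0"
      by (metis diff_self)
    from scaleR_eq_0_iff[THEN iffD1, OF this] show False using t(1) False by auto
  qed
  ultimately have "?m \<in> open_segment (?m - t *\<^sub>R p) (?m + t *\<^sub>R p)"
    by (metis midpoint_in_open_segment)
  then have "?m + t *\<^sub>R p \<in> E"
    using face_ofD[OF E'(1) _ t(3,2) mE] by blast
  moreover have "collinear E"
    using E'(2) by (simp add: collinear_aff_dim)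
  ultimately have "collinear {z, z', ?m + t *\<^sub>R p}"
    using z collinear_subset[of E "{z, z', ?m + t *\<^sub>R p}"] by simp
  then have "?m + t *\<^sub>R p \<in> affine hull {z, z'}"
    using collinear_3_affine_hull[OF z(3)] by blast
  then obtain s where s: "?m + t *\<^sub>R p = z + s *\<^sub>R (z' - z)"
    unfolding affine_hull_2_alt by blast
  have m: "?m = z + (1/2) *\<^sub>R (z' - z)"
    using scaleR_half_double[of z]
    by (simp add: midpoint_def scaleR_right_diff_distrib scaleR_right_distrib eq_diff_eq)
  have "t *\<^sub>R p = (?m + t *\<^sub>R p) - ?m"
    by simp
  also have "\<dots> = (z + s *\<^sub>R (z' - z)) - (z + (1/2) *\<^sub>R (z' - z))"
    by (rule arg_cong2[OF s m])
  also have "\<dots> = s *\<^sub>R (z' - z) - (1/2) *\<^sub>R (z' - z)"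
    by simp
  finally have "t *\<^sub>R p = s *\<^sub>R (z' - z) - (1/2) *\<^sub>R (z' - z)" .
  then have "t *\<^sub>R p = (s - 1/2) *\<^sub>R (z' - z)"
    by (simp only: scaleR_left_diff_distrib)
  then have "inverse t *\<^sub>R (t *\<^sub>R p) = (inverse t * (s - 1/2)) *\<^sub>R (z' - z)"
    by (simp only: scaleR_scaleR)
  then have "p = (inverse t * (s - 1/2)) *\<^sub>R (z' - z)"
    using t(1) by simp
  then show ?thesis ..
qed

section \<open>Facets and irredundant descriptions\<close>

text \<open>The points in \<open>wit\<close> certify that every constraint is irredundant, and
  irredundant constraints correspond bijectively to facets.\<close>

lemma facets_of_cell:
  assumes A: "subspace A" and K: "finite K"
    and p0: "p0 \<in> A" "\<And>k. k \<in> K \<Longrightarrow> a k \<bullet> p0 < b k"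
    and wit: "\<And>k. k \<in> K \<Longrightarrow> \<exists>p\<in>A. a k \<bullet> p = b k \<and> (\<forall>l\<in>K - {k}. a l \<bullet> p < b l)"
  shows "affine hull cell A K a b = A"
    and "polytope_facets (cell A K a b) = (\<lambda>k. cell A K a b \<inter> {x. a k \<bullet> x = b k}) ` K"
    and "card (polytope_facets (cell A K a b)) = card K"
proof -
  let ?S = "cell A K a b"
  define H where "H = (\<lambda>k. {x. a k \<bullet> x \<le> b k})"
  have S: "?S = A \<inter> (\<Inter>(H ` K))"
    by (auto simp: cell_def H_def)
  let ?O = "\<Inter>k\<in>K. {x. a k \<bullet> x < b k}"
  have "open ?O"
    using K by (intro open_INT) (auto simp: open_halfspace_lt)
  moreover have "p0 \<in> A \<inter> ?O"
    using p0 by auto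
  ultimately have "affine hull (A \<inter> ?O) = affine hull A"
    by (intro affine_hull_affine_Int_open subspace_imp_affine[OF A]) blast+
  also have "\<dots> = A"
    using subspace_imp_affine[OF A] by (simp only: affine_hull_eq)
  finally have "affine hull (A \<inter> ?O) = A" .
  moreover have "affine hull (A \<inter> ?O) \<subseteq> affine hull ?S"
    by (rule hull_mono) (auto simp: cell_def intro: less_imp_le)
  moreover have "affine hull ?S \<subseteq> A"
    by (rule hull_minimal) (auto simp: cell_def subspace_imp_affine[OF A])
  ultimately show hull: "affine hull ?S = A" by blast
  have nz: "a k \<noteq> 0" if "k \<in> K" for k
    using wit[OF that] p0(2)[OF that] by force
  \<comment> \<open>Moving the witness of k slightly away from the interior point \<open>p0\<close>
    violates k and no other constraint.\<close>
  have beyond: "\<exists>q\<in>A. q \<notin> H k \<and> (\<forall>l\<in>K - {k}. q \<in> H l)" if k: "k \<in> K" for k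
  proof -
    obtain p where p: "p \<in> A" "a k \<bullet> p = b k" "\<And>l. l \<in> K - {k} \<Longrightarrow> a l \<bullet> p < b l"
      using wit[OF k] by blast
    obtain t where t: "t > 0" "\<And>l. l \<in> K - {k} \<Longrightarrow> a l \<bullet> p + t * (a l \<bullet> (p - p0)) < b l"
      using small_step[of "K - {k}" "\<lambda>l. a l \<bullet> p" b "\<lambda>l. a l \<bullet> (p - p0)"] p(3) K by auto
    have "t * (a k \<bullet> (p - p0)) > 0"
      using p0(2)[OF k] p(2) t(1) by (simp add: inner_diff_right)
    then show ?thesis
      using p t(2) p0(1) A
      by (intro bexI[of _ "p + t *\<^sub>R (p - p0)"])
        (auto simp: H_def inner_add_right intro: less_imp_le subspace_add subspace_scale subspace_diff)
  qed
  have inj: "inj_on H K"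
  proof (rule inj_onI)
    fix k l assume "k \<in> K" "l \<in> K" "H k = H l"
    then show "k = l" using beyond[of k] by auto
  qed
  have psub: "?S \<subset> affine hull ?S \<inter> \<Inter>F'" if F': "F' \<subset> H ` K" for F'
  proof -
    obtain k where k: "k \<in> K" "H k \<notin> F'" using F' by auto
    obtain q where q: "q \<in> A" "q \<notin> H k" "\<And>l. l \<in> K - {k} \<Longrightarrow> q \<in> H l"
      using beyond[OF k(1)] by blast
    have "q \<in> \<Inter>F'" using q(3) F' k(2) by fastforce
    moreover have "q \<notin> ?S" using q(2) k(1) S by auto
    moreover have "?S \<subseteq> A \<inter> \<Inter>F'" using F' S by auto
    ultimately show ?thesis using q(1) unfolding hull by blast
  qed
  let ?a = "\<lambda>h. a (inv_into K H h)" and ?b = "\<lambda>h. b (inv_into K H h)"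
  have "C facet_of ?S \<longleftrightarrow> (\<exists>h. h \<in> H ` K \<and> C = ?S \<inter> {x. ?a h \<bullet> x = ?b h})" for C
  proof (rule facet_of_polyhedron_explicit)
    show "finite (H ` K)" using K by simp
    show "?S = affine hull ?S \<inter> \<Inter>(H ` K)" using hull S by simp
    show "?a h \<noteq> 0 \<and> h = {x. ?a h \<bullet> x \<le> ?b h}" if "h \<in> H ` K" for h
      using that nz inj by (auto simp: H_def[symmetric] inv_into_f_f) (auto simp: H_def)
  qed (use psub in auto)
  then show facets: "polytope_facets ?S = (\<lambda>k. ?S \<inter> {x. a k \<bullet> x = b k}) ` K"
    using inj by (auto simp: polytope_facets_def inv_into_f_f)
  have "inj_on (\<lambda>k. ?S \<inter> {x. a k \<bullet> x = b k}) K"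
  proof (rule inj_onI)
    fix k l assume kl: "k \<in> K" "l \<in> K" "?S \<inter> {x. a k \<bullet> x = b k} = ?S \<inter> {x. a l \<bullet> x = b l}"
    obtain p where p: "p \<in> A" "a k \<bullet> p = b k" "\<And>l. l \<in> K - {k} \<Longrightarrow> a l \<bullet> p < b l"
      using wit[OF kl(1)] by blast
    then have "p \<in> ?S \<inter> {x. a k \<bullet> x = b k}"
      by (auto simp: cell_def) (metis Diff_iff less_imp_le order_refl singletonD)
    then have "a l \<bullet> p = b l" using kl(3) by auto
    then show "k = l" using p(3)[of l] kl(2) by auto
  qed
  then show "card (polytope_facets ?S) = card K"
    unfolding facets by (rule card_image)
qed

text \<open>A converse to \<open>facets_of_cell\<close>. With the facets themselves as labels,
  counting constraints is counting facets. The normals lie in A because each of them, added to 0,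
  stays in the affine hull.\<close>

lemma facet_representation:
  fixes P :: "'a::euclidean_space set"
  assumes P: "polyhedron P" "P \<noteq> {}" and A: "affine hull P = A" "subspace A"
  obtains a b where "finite (polytope_facets P)"
    and "\<And>F. F \<in> polytope_facets P \<Longrightarrow> a F \<in> A"
    and "\<And>F. F \<in> polytope_facets P \<Longrightarrow> F = P \<inter> {x. a F \<bullet> x = b F}"
    and "P = cell A (polytope_facets P) a b"
    and "\<exists>p\<in>A. \<forall>F\<in>polytope_facets P. a F \<bullet> p < b F"
    and "\<And>F. F \<in> polytope_facets P \<Longrightarrow>
           \<exists>p\<in>A. a F \<bullet> p = b F \<and> (\<forall>G\<in>polytope_facets P - {F}. a G \<bullet> p < b G)"
proof -
  obtain \<H> where fin: "finite \<H>" and eq: "P = affine hull P \<inter> \<Inter>\<H>"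
    and hs: "\<forall>h\<in>\<H>. \<exists>a b. a \<noteq> 0 \<and> h = {x. a \<bullet> x \<le> b} \<and> (\<forall>x\<in>affine hull P. x + a \<in> affine hull P)"
    and min: "\<forall>F'. F' \<subset> \<H> \<longrightarrow> P \<subset> affine hull P \<inter> \<Inter>F'"
    using P(1)[unfolded polyhedron_Int_affine_parallel_minimal] by (elim exE conjE) (rule that)
  from hs obtain \<alpha> \<beta> where ab: "\<And>h. h \<in> \<H> \<Longrightarrow> \<alpha> h \<noteq> 0 \<and> h = {x. \<alpha> h \<bullet> x \<le> \<beta> h}"
    and par: "\<And>h x. h \<in> \<H> \<Longrightarrow> x \<in> A \<Longrightarrow> x + \<alpha> h \<in> A"
    unfolding A(1) by metis
  have inA: "\<alpha> h \<in> A" if "h \<in> \<H>" for h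
    using par[OF that, of 0] subspace_0[OF A(2)] by simp
  have facet_iff: "C facet_of P \<longleftrightarrow> (\<exists>h. h \<in> \<H> \<and> C = P \<inter> {x. \<alpha> h \<bullet> x = \<beta> h})" for C
    by (rule facet_of_polyhedron_explicit[OF fin eq ab]) (use min in auto)
  have "rel_interior P \<noteq> {}"
    using P polyhedron_imp_convex rel_interior_eq_empty by blast
  then obtain x0 where "x0 \<in> rel_interior P" by blast
  then have x0P: "x0 \<in> P" and x0: "\<And>h. h \<in> \<H> \<Longrightarrow> \<alpha> h \<bullet> x0 < \<beta> h"
    using rel_interior_polyhedron_explicit[OF fin eq ab] min by auto
  have hmem: "x \<in> h \<longleftrightarrow> \<alpha> h \<bullet> x \<le> \<beta> h" if "h \<in> \<H>" for h x
    using ab[OF that, THEN conjunct2] by (metis mem_Collect_eq)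
  have mem: "x \<in> P \<longleftrightarrow> x \<in> A \<and> (\<forall>h\<in>\<H>. \<alpha> h \<bullet> x \<le> \<beta> h)" for x
    by (subst eq) (simp add: A(1) hmem)
  have wit: "\<exists>p\<in>A. \<alpha> h \<bullet> p = \<beta> h \<and> (\<forall>k\<in>\<H> - {h}. \<alpha> k \<bullet> p < \<beta> k)" if h: "h \<in> \<H>" for h
  proof -
    have "P \<subset> affine hull P \<inter> \<Inter>(\<H> - {h})"
      using h by (intro min[rule_format]) blast
    then obtain q where q: "q \<in> A" "q \<in> \<Inter>(\<H> - {h})" "q \<notin> P"
      using A(1) by blast
    then have qh: "\<alpha> h \<bullet> q > \<beta> h" and qk: "\<And>k. k \<in> \<H> - {h} \<Longrightarrow> \<alpha> k \<bullet> q \<le> \<beta> k"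
      using mem[of q] hmem by (auto simp: not_le)
    \<comment> \<open>The segment from the relative interior point \<open>x0\<close> to q crosses
      the hyperplane of h at parameter t. Since q violates only h, all other constraints are strict
      there.\<close>
    define t where "t = (\<beta> h - \<alpha> h \<bullet> x0) / (\<alpha> h \<bullet> q - \<alpha> h \<bullet> x0)"
    have t: "0 < t" "t < 1" "\<alpha> h \<bullet> x0 + t * (\<alpha> h \<bullet> q - \<alpha> h \<bullet> x0) = \<beta> h"
      using qh x0[OF h] by (auto simp: t_def)
    let ?p = "x0 + t *\<^sub>R (q - x0)"
    have "?p \<in> A"
      using A(2) q(1) x0P mem by (intro subspace_add subspace_scale subspace_diff) auto
    moreover have "\<alpha> k \<bullet> ?p < \<beta> k" if "k \<in> \<H> - {h}" for k
    proof -
      have "\<alpha> k \<bullet> ?p = (1 - t) * (\<alpha> k \<bullet> x0) + t * (\<alpha> k \<bullet> q)"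
        by (simp add: inner_add_right inner_diff_right algebra_simps)
      also have "\<dots> < (1 - t) * \<beta> k + t * \<beta> k"
        using t x0[of k] qk[OF that] that by (intro add_less_le_mono mult_strict_left_mono mult_left_mono) auto
      finally show ?thesis by (simp add: algebra_simps)
    qed
    ultimately show ?thesis
      using t(3) by (intro bexI[of _ ?p]) (auto simp: inner_add_right inner_diff_right)
  qed
  let ?F = "\<lambda>h. P \<inter> {x. \<alpha> h \<bullet> x = \<beta> h}"
  have inj: "inj_on ?F \<H>"
  proof (rule inj_onI)
    fix h k assume hk: "h \<in> \<H>" "k \<in> \<H>" "?F h = ?F k"
    obtain p where p: "p \<in> A" "\<alpha> h \<bullet> p = \<beta> h" "\<And>k. k \<in> \<H> - {h} \<Longrightarrow> \<alpha> k \<bullet> p < \<beta> k"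
      using wit[OF hk(1)] by blast
    then have "p \<in> ?F h"
      unfolding mem Int_iff mem_Collect_eq by (metis Diff_iff less_imp_le order_refl singletonD)
    then have "\<alpha> k \<bullet> p = \<beta> k" using hk(3) by blast
    then show "h = k" using p(3)[of k] hk(2) by auto
  qed
  have facets: "polytope_facets P = ?F ` \<H>"
    by (auto simp: polytope_facets_def facet_iff)
  let ?i = "inv_into \<H> ?F"
  have i: "?i (?F h) = h" if "h \<in> \<H>" for h
    using inv_into_f_f[OF inj that] .
  show thesis
  proof (rule that[of "\<lambda>F. \<alpha> (?i F)" "\<lambda>F. \<beta> (?i F)"])
    show "finite (polytope_facets P)"
      using fin facets by simp
    show "\<alpha> (?i F) \<in> A" if "F \<in> polytope_facets P" for F
    proof -
      obtain h where "h \<in> \<H>" "F = ?F h" using \<open>F \<in> _\<close> facets by blast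
      then show ?thesis using i inA by simp
    qed
    show "F = P \<inter> {x. \<alpha> (?i F) \<bullet> x = \<beta> (?i F)}" if "F \<in> polytope_facets P" for F
    proof -
      obtain h where h: "h \<in> \<H>" "F = ?F h" using \<open>F \<in> _\<close> facets by blast
      then have "?i F = h" using i by simp
      with h(2) show ?thesis by (simp only:)
    qed
    show "P = cell A (polytope_facets P) (\<lambda>F. \<alpha> (?i F)) (\<lambda>F. \<beta> (?i F))"
      using i unfolding facets by (auto simp: cell_def mem)
    show "\<exists>p\<in>A. \<forall>F\<in>polytope_facets P. \<alpha> (?i F) \<bullet> p < \<beta> (?i F)"
      using i x0 x0P mem unfolding facets by (intro bexI[of _ x0]) auto
    show "\<exists>p\<in>A. \<alpha> (?i F) \<bullet> p = \<beta> (?i F) \<and>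
        (\<forall>G\<in>polytope_facets P - {F}. \<alpha> (?i G) \<bullet> p < \<beta> (?i G))" if F: "F \<in> polytope_facets P" for F
    proof -
      obtain h where h: "h \<in> \<H>" "F = ?F h" using F facets by blast
      obtain p where p: "p \<in> A" "\<alpha> h \<bullet> p = \<beta> h" "\<And>k. k \<in> \<H> - {h} \<Longrightarrow> \<alpha> k \<bullet> p < \<beta> k"
        using wit[OF h(1)] by blast
      have "\<alpha> (?i G) \<bullet> p < \<beta> (?i G)" if "G \<in> polytope_facets P - {F}" for G
      proof -
        have "G \<in> ?F ` \<H>" using that by (simp only: facets DiffD1)
        then obtain k where k: "G = ?F k" "k \<in> \<H>" by (rule imageE)
        then have "k \<noteq> h" using that h(2) by blast
        then show ?thesis using p(3)[of k] k i by simp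
      qed
      then show ?thesis using p h i by auto
    qed
  qed
qed

section \<open>Normals at a vertex\<close>

text \<open>A nonzero vector of A orthogonal to all normals tight at w could be added to w without
  leaving the tight hyperplanes, against \<open>vertex_cell_unique\<close>.\<close>

lemma span_normals_vertex:
  assumes A: "subspace A" and K: "finite K" and inA: "\<And>k. k \<in> K \<Longrightarrow> a k \<in> A"
    and w: "w extreme_point_of cell A K a b"
  shows "span (a ` {k \<in> K. a k \<bullet> w = b k}) = A"
proof (rule ccontr)
  let ?U = "{k \<in> K. a k \<bullet> w = b k}"
  assume "span (a ` ?U) \<noteq> A"
  moreover have "span (a ` ?U) \<subseteq> A"
    using inA A by (intro span_minimal) auto
  ultimately have "span (a ` ?U) \<subset> span A"
    using A by (metis psubsetI span_eq_iff)
  then obtain x where x: "x \<noteq> 0" "x \<in> span A" "\<And>y. y \<in> span (a ` ?U) \<Longrightarrow> orthogonal x y"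
    using orthogonal_to_subspace_exists_gen by blast
  have "w \<in> A"
    using w by (simp add: extreme_point_of_def cell_def)
  moreover have "x \<in> A"
    using x(2) A by (metis span_eq_iff)
  moreover have "a k \<bullet> (w + x) = b k" if "k \<in> K" "a k \<bullet> w = b k" for k
    using that x(3)[of "a k"] by (simp add: inner_add_right orthogonal_def inner_commute span_base)
  ultimately have "w + x = w"
    using vertex_cell_unique[OF A K w, of "w + x"] A by (simp add: subspace_add)
  then show False using x(1) by simp
qed

text \<open>A basis taken from the normals uses only dim A labels. The labels are chosen
  injectively, since distinct labels may carry the same normal; any label outside the choice can be
  spared.\<close>

lemma exists_redundant_normal:
  assumes "finite U" "span (a ` U) = A" "dim A < card U"
  shows "\<exists>i\<in>U. span (a ` (U - {i})) = A"
proof -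
  obtain B where B: "B \<subseteq> a ` U" "a ` U \<subseteq> span B" "card B = dim (a ` U)"
    using basis_exists[of "a ` U"] by metis
  obtain C where C: "C \<subseteq> U" "inj_on a C" "B = a ` C"
    using B(1) unfolding subset_image_inj by blast
  have "card C < card U"
    using B(3) C assms by (metis card_image dim_span)
  then obtain i where i: "i \<in> U" "i \<notin> C"
    using C(1) by (metis order_less_irrefl subsetI subset_antisym)
  have "a ` U \<subseteq> span (a ` (U - {i}))"
    using B(2) C i span_mono[of B "a ` (U - {i})"] by blast
  then have "span (a ` U) \<subseteq> span (a ` (U - {i}))"
    by (simp add: span_minimal)
  moreover have "span (a ` (U - {i})) \<subseteq> span (a ` U)"
    by (intro span_mono) blast
  ultimately show ?thesis using i assms(2) by blast
qed

text \<open>For the map f below, \<open>f x \<bullet> x\<close> is the sum of the squared inner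
  products, so f is injective on A, and an injective linear map on a subspace is bounded below. This
  later confines the points beyond facet i to a small ball.\<close>

lemma norm_le_sum_inner_spanning:
  fixes a :: "'k \<Rightarrow> 'a::euclidean_space"
  assumes "finite V" "span (a ` V) = A"
  shows "\<exists>R>0. \<forall>x\<in>A. norm x \<le> R * (\<Sum>k\<in>V. \<bar>a k \<bullet> x\<bar>)"
proof -
  define f where "f = (\<lambda>x. \<Sum>k\<in>V. (a k \<bullet> x) *\<^sub>R a k)"
  have "bounded_linear f"
    unfolding f_def by (intro bounded_linear_sum bounded_linear_scaleR_const bounded_linear_inner_right)
  moreover have "x = 0" if x: "x \<in> A" "f x = 0" for x
  proof -
    have "(\<Sum>k\<in>V. (a k \<bullet> x)\<^sup>2) = f x \<bullet> x"
      by (simp add: f_def inner_sum_left power2_eq_square)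
    then have "\<forall>k\<in>V. a k \<bullet> x = 0"
      using x(2) assms(1) by (simp add: sum_nonneg_eq_0_iff)
    then have "orthogonal x y" if "y \<in> span (a ` V)" for y
      by (intro orthogonal_to_span[OF that]) (auto simp: orthogonal_def inner_commute)
    then show ?thesis using x(1) assms(2) by (metis orthogonal_self)
  qed
  ultimately obtain e where e: "e > 0" "\<And>x. x \<in> A \<Longrightarrow> norm (f x) \<ge> e * norm x"
    using injective_imp_isometric[of A f] assms(2) by (metis closed_span subspace_span)
  define M where "M = (\<Sum>k\<in>V. norm (a k)) + 1"
  have M: "M > 0" unfolding M_def by (intro add_nonneg_pos sum_nonneg) auto
  have "norm x \<le> M / e * (\<Sum>k\<in>V. \<bar>a k \<bullet> x\<bar>)" if "x \<in> A" for x
  proof -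
    have "norm (f x) \<le> (\<Sum>k\<in>V. \<bar>a k \<bullet> x\<bar> * norm (a k))"
      unfolding f_def by (rule order_trans[OF norm_sum]) simp
    also have "\<dots> \<le> (\<Sum>k\<in>V. \<bar>a k \<bullet> x\<bar>) * M"
      unfolding sum_distrib_right
    proof (intro sum_mono mult_left_mono)
      fix k assume "k \<in> V"
      then have "norm (a k) \<le> (\<Sum>k\<in>V. norm (a k))"
        using assms(1) by (intro member_le_sum) auto
      then show "norm (a k) \<le> M" by (simp add: M_def)
    qed simp
    finally have "e * norm x \<le> M * (\<Sum>k\<in>V. \<bar>a k \<bullet> x\<bar>)"
      using e(2)[OF that] by (simp add: mult.commute[of M])
    then show ?thesis using e(1) by (simp add: field_simps)
  qed
  then show ?thesis using e(1) M by (intro exI[of _ "M / e"]) auto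
qed

subsection \<open>Affine copies\<close>

text \<open>f and g undo each other only on S and its image, as the two spaces may differ in
  dimension. Linear maps do not raise the affine dimension; applying this in both directions gives
  equality.\<close>

lemma face_of_affine_image:
  assumes "linear L" "linear M" and f: "f = (\<lambda>x. L x + c)" and g: "g = (\<lambda>y. M y + c')"
    and inv: "\<forall>x\<in>S. g (f x) = x" and T: "T face_of S"
  shows "f ` T face_of f ` S" "aff_dim (f ` T) = aff_dim T"
proof -
  have f_seg: "f ((1 - t) *\<^sub>R x + t *\<^sub>R y) = (1 - t) *\<^sub>R f x + t *\<^sub>R f y" for t x y
    using assms(1) by (simp add: f linear_add linear_scale linear_diff algebra_simps)
  have g_seg: "g ((1 - t) *\<^sub>R x + t *\<^sub>R y) = (1 - t) *\<^sub>R g x + t *\<^sub>R g y" for t x y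
    using assms(2) by (simp add: g linear_add linear_scale linear_diff algebra_simps)
  have sub: "T \<subseteq> S" and conv: "convex T"
    using T by (auto simp: face_of_def)
  show "f ` T face_of f ` S"
    unfolding face_of_def
  proof (intro conjI ballI impI)
    show "f ` T \<subseteq> f ` S" using sub by blast
    show "convex (f ` T)"
      using conv unfolding convex_alt by (force simp: f_seg[symmetric])
    fix a b x assume *: "a \<in> f ` S" "b \<in> f ` S" "x \<in> f ` T" "x \<in> open_segment a b"
    then obtain a' b' x' where a': "a = f a'" "a' \<in> S" and b': "b = f b'" "b' \<in> S"
      and x': "x = f x'" "x' \<in> T" by blast
    obtain t where t: "0 < t" "t < 1" "x = (1 - t) *\<^sub>R a + t *\<^sub>R b" "a \<noteq> b"
      using *(4) by (auto simp: in_segment)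
    then have "x' = (1 - t) *\<^sub>R a' + t *\<^sub>R b'"
      using g_seg[of t a b] a' b' x' inv sub by (metis subsetD)
    then have "x' \<in> open_segment a' b'"
      using t a' b' by (auto simp: in_segment)
    then have "a' \<in> T \<and> b' \<in> T"
      using face_ofD[OF T _ a'(2) b'(2) x'(2)] by blast
    then show "a \<in> f ` T" "b \<in> f ` T" using a' b' by blast+
  qed
  have le: "aff_dim ((\<lambda>x. L x + c) ` X) \<le> aff_dim X" if "linear L"
    for L :: "'x::euclidean_space \<Rightarrow> 'y::euclidean_space" and c X
  proof -
    have "(\<lambda>x. L x + c) ` X = (+) c ` (L ` X)"
      by (auto simp: image_image add.commute)
    then show ?thesis
      using aff_dim_linear_image_le[OF that, of X] by (simp only: aff_dim_translation_eq)
  qed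
  have "g ` f ` T = T"
    using inv sub by (force simp: image_image)
  then show "aff_dim (f ` T) = aff_dim T"
    using le[OF assms(1), of c T] le[OF assms(2), of c' "f ` T"] by (simp add: f g)
qed

lemma affine_image_vertices_facets_adj:
  assumes "linear L" "linear M" and f: "f = (\<lambda>x. L x + c)" and g: "g = (\<lambda>y. M y + c')"
    and inv: "\<forall>x\<in>S. g (f x) = x" and convex: "convex S"
  shows "x \<in> polytope_vertices S \<Longrightarrow> f x \<in> polytope_vertices (f ` S)"
    and "F \<in> polytope_facets S \<Longrightarrow> f ` F \<in> polytope_facets (f ` S)"
    and "polytope_adj S x y \<Longrightarrow> polytope_adj (f ` S) (f x) (f y)"
proof -
  note face = face_of_affine_image[OF assms(1-5)]
  have vert: "f x \<in> polytope_vertices (f ` S)" if "x \<in> polytope_vertices S" for x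
  proof -
    have "{x} face_of S"
      using that by (simp add: polytope_vertices_def face_of_singleton)
    then have "f ` {x} face_of f ` S"
      by (rule face(1))
    then show ?thesis
      by (simp add: polytope_vertices_def face_of_singleton)
  qed
  then show "x \<in> polytope_vertices S \<Longrightarrow> f x \<in> polytope_vertices (f ` S)" .
  show "f ` F \<in> polytope_facets (f ` S)" if "F \<in> polytope_facets S"
  proof -
    have F: "F face_of S" "F \<noteq> {}" "aff_dim F = aff_dim S - 1"
      using that by (auto simp: polytope_facets_def facet_of_def)
    then show ?thesis
      using face[OF F(1)] face(2)[OF face_of_refl[OF convex]] by (simp add: polytope_facets_def facet_of_def)
  qed
  show "polytope_adj (f ` S) (f x) (f y)" if adj: "polytope_adj S x y"
  proof -
    obtain e where e: "e edge_of S" "x \<in> e" "y \<in> e"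
      using adj by (auto simp: polytope_adj_def)
    have "f x \<noteq> f y"
      using adj inv e by (metis edge_of_imp_subset polytope_adj_def subsetD)
    moreover have "f ` e edge_of f ` S"
      using e(1) face[of e] by (simp add: edge_of_def)
    ultimately show ?thesis
      using adj e vert by (auto simp: polytope_adj_def)
  qed
qed

text \<open>The directions of S span a space of dimension d, which is isometric to a subspace of the
  target. The base point u goes to 0 so that the affine hull of the copy is linear.\<close>

lemma exists_affine_copy:
  fixes S :: "'a::euclidean_space set"
  assumes "aff_dim S = int d" "d \<le> DIM('b::euclidean_space)" "u \<in> S"
  obtains L :: "'a \<Rightarrow> 'b::euclidean_space" and M c c' where "linear L" "linear M"
    and "\<And>x. x \<in> S \<Longrightarrow> M (L x + c) + c' = x" and "L u + c = 0"
proof -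
  let ?V = "span ((\<lambda>x. - u + x) ` S)"
  have "aff_dim S = aff_dim ((\<lambda>x. - u + x) ` S)"
    by (simp only: aff_dim_translation_eq)
  also have "\<dots> = int (dim ((\<lambda>x. - u + x) ` S))"
    using assms(3) by (intro aff_dim_zero hull_inc) force
  finally have dimV: "dim ?V = d"
    using assms(1) by simp
  obtain T :: "'b set" where T: "subspace T" "dim T = d"
    using choose_subspace_of_subspace[of d "UNIV :: 'b set"] assms(2) by auto
  obtain L :: "'a \<Rightarrow> 'b" and M where LM: "linear L" "linear M" "\<And>x. x \<in> ?V \<Longrightarrow> M (L x) = x"
    using isometries_subspaces[of ?V T] T dimV by (metis subspace_span)
  show thesis
  proof (rule that[OF LM(1,2), of "- L u" u])
    show "M (L x + - L u) + u = x" if "x \<in> S" for x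
    proof -
      have "M (L (- u + x)) = - u + x"
        using that by (intro LM(3) span_base) blast
      then show ?thesis
        using LM(1) by (simp add: linear_diff)
    qed
  qed simp
qed

text \<open>This serves two purposes: it moves a spindle into a type with enough dimensions, and
  before every wedge it puts the chosen apex at the origin.\<close>

lemma spindle_affine_copy:
  fixes P :: "'a::euclidean_space set"
  assumes P: "spindle P u v" "aff_dim P = int d" "d \<le> DIM('b::euclidean_space)"
  obtains Q :: "'b::euclidean_space set" and w where "spindle Q 0 w" "aff_dim Q = int d"
    "card (polytope_facets Q) = card (polytope_facets P)"
    "card {F \<in> polytope_facets Q. 0 \<in> F} = card {F \<in> polytope_facets P. u \<in> F}"
    "graph_dist P u v \<le> graph_dist Q 0 w"
proof -
  have poly: "polytope P" and u: "u \<in> polytope_vertices P" and v: "v \<in> polytope_vertices P"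
    and "u \<noteq> v" and facet: "\<And>F. F \<in> polytope_facets P \<Longrightarrow> (u \<in> F) \<noteq> (v \<in> F)"
    using P(1) by (auto simp: spindle_def)
  have uv: "u \<in> P" "v \<in> P"
    using u v by (auto simp: polytope_vertices_def extreme_point_of_def)
  obtain L :: "'a \<Rightarrow> 'b" and M c c' where LM: "linear L" "linear M"
    and inv: "\<And>x. x \<in> P \<Longrightarrow> M (L x + c) + c' = x" and 0: "L u + c = 0"
    using exists_affine_copy[OF P(2,3) uv(1)] by metis
  define f where "f = (\<lambda>x. L x + c)"
  define g where "g = (\<lambda>y. M y + c')"
  define Q where "Q = f ` P"
  have gf: "\<forall>x\<in>P. g (f x) = x"
    using inv by (simp add: f_def g_def)
  then have fg: "\<forall>y\<in>Q. f (g y) = y"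
    by (auto simp: Q_def)
  have gQ: "g ` Q = P"
    using gf by (force simp: Q_def image_image)
  note fwd = affine_image_vertices_facets_adj[OF LM f_def g_def gf polytope_imp_convex[OF poly],
      folded Q_def]
  have "Q = (+) c ` L ` P"
    by (auto simp: Q_def f_def image_image add.commute)
  then have polyQ: "polytope Q"
    using poly LM(1) by (simp only: polytope_linear_image polytope_translation_eq)
  note bwd = affine_image_vertices_facets_adj[OF LM(2,1) g_def f_def fg
      polytope_imp_convex[OF polyQ], unfolded gQ]
  have dimQ: "aff_dim Q = int d"
    using face_of_affine_image(2)[OF LM f_def g_def gf face_of_refl] poly P(2)
    by (simp add: Q_def polytope_imp_convex)
  have sub: "F \<subseteq> P" if "F \<in> polytope_facets P" for F
    using that by (auto simp: polytope_facets_def dest: facet_of_imp_subset)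
  have subQ: "F \<subseteq> Q" if "F \<in> polytope_facets Q" for F
    using that by (auto simp: polytope_facets_def dest: facet_of_imp_subset)
  have bij: "bij_betw ((`) f) (polytope_facets P) (polytope_facets Q)"
  proof (rule bij_betw_byWitness[where f' = "(`) g"])
    show "\<forall>F\<in>polytope_facets P. g ` f ` F = F"
      using sub gf by (force simp: image_image)
    show "\<forall>F\<in>polytope_facets Q. f ` g ` F = F"
      using subQ fg by (force simp: image_image)
  qed (use fwd(2) bwd(2) in auto)
  have mem: "f x \<in> f ` F \<longleftrightarrow> x \<in> F" if "x \<in> P" "F \<in> polytope_facets P" for x F
    using sub[OF that(2)] that(1) gf by (metis (no_types, lifting) image_iff subsetD)
  have img: "(`) f ` polytope_facets P = polytope_facets Q"
    using bij by (rule bij_betw_imp_surj_on)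
  have "{F \<in> polytope_facets Q. f u \<in> F} = (`) f ` {F \<in> polytope_facets P. u \<in> F}"
    unfolding img[symmetric] using mem uv(1) by blast
  moreover have "inj_on ((`) f) {F \<in> polytope_facets P. u \<in> F}"
    using bij_betw_imp_inj_on[OF bij] by (rule inj_on_subset) blast
  ultimately have card_u: "card {F \<in> polytope_facets Q. f u \<in> F} = card {F \<in> polytope_facets P. u \<in> F}"
    by (simp add: card_image)
  have "(f u \<in> F) \<noteq> (f v \<in> F)" if F: "F \<in> polytope_facets Q" for F
    using F facet mem uv unfolding img[symmetric] by blast
  moreover have "f u \<noteq> f v"
    using \<open>u \<noteq> v\<close> gf uv by metis
  ultimately have "spindle Q (f u) (f v)"
    using polyQ fwd(1) u v by (auto simp: spindle_def)
  moreover have "graph_dist P (g (f u)) (g (f v)) \<le> graph_dist Q (f u) (f v)"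
    by (rule graph_dist_image_le) (use bwd in auto)
  then have "graph_dist P u v \<le> graph_dist Q (f u) (f v)"
    using gf uv by simp
  moreover have "f u = 0"
    using 0 by (simp add: f_def)
  ultimately show thesis
    using that[of Q "f v"] dimQ bij_betw_same_card[OF bij] card_u by simp
qed

subsection \<open>The tilted wedge\<close>

text \<open>\<open>P\<close> is the cell cut out by \<open>a k \<bullet> x \<le> b k\<close>, with apices \<open>0\<close> and \<open>v\<close>, so that \<open>b k = 0\<close> says that
  facet \<open>k\<close> contains \<open>0\<close>. The wedge is taken over facet \<open>j\<close> in the direction \<open>e\<close>. Facet \<open>i\<close> is
  replaced by the hyperplane with normal \<open>h + \<delta> e\<close>, where \<open>h\<close> is \<open>a i\<close> pushed off all points of facet
  \<open>i\<close> except \<open>0\<close>. Dropping the constraint \<open>i\<close> adds only points close to \<open>0\<close>: this is the content of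
  \<open>near\<close> and \<open>\<rho>\<close>.\<close>

locale wedge =
  fixes A :: "'a::euclidean_space set" and I :: "'k set" and a :: "'k \<Rightarrow> 'a" and b :: "'k \<Rightarrow> real"
    and i j :: 'k and v e h :: 'a and \<delta> \<rho> :: real
  assumes A: "subspace A" and I: "finite I" and aA: "\<And>k. k \<in> I \<Longrightarrow> a k \<in> A" and hA: "h \<in> A"
    and b_nonneg: "\<And>k. k \<in> I \<Longrightarrow> 0 \<le> b k"
    and i: "i \<in> I" "b i = 0" and j: "j \<in> I" "0 < b j"
    and v: "v extreme_point_of cell A I a b"
    and apices: "\<And>k. k \<in> I \<Longrightarrow> b k = 0 \<longleftrightarrow> a k \<bullet> v \<noteq> b k"
    and spanning: "span (a ` {k \<in> I - {i}. b k = 0}) = A"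
    and interior: "\<exists>p\<in>A. \<forall>k\<in>I. a k \<bullet> p < b k"
    and irredundant: "\<And>k. k \<in> I \<Longrightarrow> \<exists>p\<in>A. a k \<bullet> p = b k \<and> (\<forall>l\<in>I - {k}. a l \<bullet> p < b l)"
    and bounded: "bounded (cell A I a b)"
    and norm_e: "norm e = 1" and orth_e: "\<And>x. x \<in> A \<Longrightarrow> e \<bullet> x = 0"
    and \<delta>: "0 < \<delta>"
    and below: "\<And>w. w extreme_point_of cell A I a b \<Longrightarrow> a i \<bullet> w < 0 \<Longrightarrow>
                  h \<bullet> w + \<delta> * (b j - a j \<bullet> w) < 0"
    and near: "\<And>x. x \<in> A \<Longrightarrow> (\<And>k. k \<in> I - {i} \<Longrightarrow> b k = 0 \<Longrightarrow> a k \<bullet> x \<le> 0) \<Longrightarrow> 0 \<le> a i \<bullet> x \<Longrightarrow>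
                  h \<bullet> x \<le> \<delta> * (b j - a j \<bullet> x) \<Longrightarrow> norm x \<le> \<rho>"
    and \<rho>: "\<And>k. k \<in> I \<Longrightarrow> 0 < b k \<Longrightarrow> norm (a k) * \<rho> < b k"
begin

abbreviation P :: "'a set" where "P \<equiv> cell A I a b"

section \<open>Coordinates of the tilted wedge\<close>

text \<open>A point (x, y) of the wedge is encoded as \<open>x + y *\<^sub>R e\<close>: the
  projection returns x, and \<open>e \<bullet> p\<close> returns y.\<close>

definition pr :: "'a \<Rightarrow> 'a" where "pr p = p - (e \<bullet> p) *\<^sub>R e"

definition A' :: "'a set" where "A' = {p. pr p \<in> A}"

text \<open>In the index set of the new polytope, \<open>Some j\<close> and \<open>None\<close> are the top and bottom of the wedge and
  \<open>Some i\<close> is the tilted facet.\<close>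

definition K :: "'k option set" where "K = insert None (Some ` I)"

text \<open>For a point with projection x and height y, the constraints \<open>Some j\<close> and
  \<open>None\<close> together say that |y| is at most the slack of facet j at x. The tilted
  constraint keeps the right-hand side 0, so its hyperplane passes through the apex 0.\<close>

definition a' :: "'k option \<Rightarrow> 'a" where
  "a' k = (case k of None \<Rightarrow> a j - e
     | Some k \<Rightarrow> if k = i then h + \<delta> *\<^sub>R e else if k = j then a j + e else a k)"

definition b' :: "'k option \<Rightarrow> real" where
  "b' k = (case k of None \<Rightarrow> b j | Some k \<Rightarrow> b k)"

definition W :: "'a set" where "W = cell A' K a' b'"

lemma i_neq_j [simp]: "i \<noteq> j" "j \<noteq> i"
  using i j by auto

lemma inner_e [simp]: "e \<bullet> e = 1" "k \<in> I \<Longrightarrow> a k \<bullet> e = 0" "h \<bullet> e = 0" "a j \<bullet> e = 0" "a i \<bullet> e = 0"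
    "k \<in> I \<Longrightarrow> e \<bullet> a k = 0" "e \<bullet> h = 0" "e \<bullet> a j = 0" "e \<bullet> a i = 0"
proof -
  have "x \<bullet> e = 0" if "x \<in> A" for x
    using orth_e[OF that] by (simp add: inner_commute)
  then show "e \<bullet> e = 1" "k \<in> I \<Longrightarrow> a k \<bullet> e = 0" "h \<bullet> e = 0" "a j \<bullet> e = 0" "a i \<bullet> e = 0"
      "k \<in> I \<Longrightarrow> e \<bullet> a k = 0" "e \<bullet> h = 0" "e \<bullet> a j = 0" "e \<bullet> a i = 0"
    using norm_e orth_e aA hA i(1) j(1) by (simp_all add: norm_eq_1)
qed

lemma pr_linear: "linear pr"
  unfolding pr_def by (intro linearI) (simp_all add: inner_add_right algebra_simps)

lemma pr_A: "x \<in> A \<Longrightarrow> pr x = x"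
  by (simp add: pr_def orth_e)

lemma pr_e: "pr e = 0"
  by (simp add: pr_def)

lemma inner_pr [simp]: "k \<in> I \<Longrightarrow> a k \<bullet> pr p = a k \<bullet> p" "h \<bullet> pr p = h \<bullet> p"
    "a j \<bullet> pr p = a j \<bullet> p" "a i \<bullet> pr p = a i \<bullet> p"
  by (simp_all add: pr_def inner_diff_right)

lemma pr_lift [simp]: "x \<in> A \<Longrightarrow> pr (x + t *\<^sub>R e) = x"
  by (simp add: linear_add[OF pr_linear] linear_scale[OF pr_linear] pr_A pr_e)

lemma A': "subspace A'"
  unfolding A'_def
  using linear_subspace_vimage[OF pr_linear A] by (simp add: vimage_def)

lemma lift_A': "x \<in> A \<Longrightarrow> x + t *\<^sub>R e \<in> A'"
  by (simp add: A'_def)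

lemma A_subset_A': "A \<subseteq> A'"
  by (auto simp: A'_def pr_A)

lemma dim_A': "dim A' = Suc (dim A)"
proof -
  have "A' = span (insert e A)"
  proof
    show "A' \<subseteq> span (insert e A)"
    proof
      fix p assume "p \<in> A'"
      then have "pr p + (e \<bullet> p) *\<^sub>R e \<in> span (insert e A)"
        by (intro span_add span_scale) (auto intro: span_base simp: A'_def)
      then show "p \<in> span (insert e A)" by (simp add: pr_def)
    qed
    show "span (insert e A) \<subseteq> A'"
      using A_subset_A' lift_A'[of 0 1] subspace_0[OF A] by (intro span_minimal A') auto
  qed
  moreover have "e \<notin> span A"
    using A orth_e[of e] by (auto simp: span_eq_iff[THEN iffD2])
  ultimately show ?thesis
    by (simp add: dim_insert)
qed

lemma finite_K: "finite K" and card_K: "card K = Suc (card I)"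
  using I by (simp_all add: K_def card_image)

lemma a'_simps [simp]: "a' None = a j - e" "a' (Some i) = h + \<delta> *\<^sub>R e" "a' (Some j) = a j + e"
    "k \<noteq> i \<Longrightarrow> k \<noteq> j \<Longrightarrow> a' (Some k) = a k"
  by (simp_all add: a'_def)

lemma b'_simps [simp]: "b' None = b j" "b' (Some k) = b k"
  by (simp_all add: b'_def)

lemma ball_K: "(\<forall>k\<in>K. Q k) \<longleftrightarrow>
    Q None \<and> Q (Some i) \<and> Q (Some j) \<and> (\<forall>k\<in>I. k \<noteq> i \<longrightarrow> k \<noteq> j \<longrightarrow> Q (Some k))"
  using i(1) j(1) by (auto simp: K_def)

lemma mem_W: "p \<in> W \<longleftrightarrow> pr p \<in> A \<and> a j \<bullet> p - e \<bullet> p \<le> b j \<and> h \<bullet> p + \<delta> * (e \<bullet> p) \<le> 0 \<and>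
    a j \<bullet> p + e \<bullet> p \<le> b j \<and> (\<forall>k\<in>I. k \<noteq> i \<longrightarrow> k \<noteq> j \<longrightarrow> a k \<bullet> p \<le> b k)"
  by (simp add: W_def cell_def ball_K A'_def inner_diff_left inner_add_left i(2) cong: conj_cong)

text \<open>The last bound is the tilted constraint at the lowest height that the wedge allows. It
  replaces constraint i in the projection and is the premise of \<open>near\<close>.\<close>

lemma mem_W_bounds:
  assumes "p \<in> W"
  shows "k \<in> I \<Longrightarrow> k \<noteq> i \<Longrightarrow> a k \<bullet> p \<le> b k" "\<bar>e \<bullet> p\<bar> \<le> b j - a j \<bullet> p"
    "h \<bullet> p \<le> \<delta> * (b j - a j \<bullet> p)"
proof -
  show *: "\<bar>e \<bullet> p\<bar> \<le> b j - a j \<bullet> p" and "k \<in> I \<Longrightarrow> k \<noteq> i \<Longrightarrow> a k \<bullet> p \<le> b k"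
    using assms unfolding mem_W by (cases "k = j"; force)+
  have "- (e \<bullet> p) \<le> b j - a j \<bullet> p" using * by simp
  then have "\<delta> * - (e \<bullet> p) \<le> \<delta> * (b j - a j \<bullet> p)"
    using \<delta> by (intro mult_left_mono) auto
  then show "h \<bullet> p \<le> \<delta> * (b j - a j \<bullet> p)"
    using assms unfolding mem_W by simp
qed

section \<open>The two apices\<close>

lemma zero_unique:
  assumes "x \<in> A" "\<And>k. k \<in> I - {i} \<Longrightarrow> b k = 0 \<Longrightarrow> a k \<bullet> x = 0"
  shows "x = 0"
proof -
  have "orthogonal x y" if "y \<in> span (a ` {k \<in> I - {i}. b k = 0})" for y
    using that by (rule orthogonal_to_span) (use assms(2) in \<open>auto simp: orthogonal_def inner_commute\<close>)
  then show ?thesis using assms(1) spanning by (metis orthogonal_self)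
qed

lemma v_unique:
  assumes "x \<in> A" "\<And>k. k \<in> I \<Longrightarrow> b k \<noteq> 0 \<Longrightarrow> a k \<bullet> x = b k"
  shows "x = v"
  using vertex_cell_unique[OF A I v assms(1)] apices assms(2) by blast

lemma v_P: "v \<in> P" and v_A: "v \<in> A"
  using v by (auto simp: extreme_point_of_def cell_def)

lemma a_i_v: "a i \<bullet> v < 0"
  using apices[OF i(1)] v_P i by (auto simp: cell_def less_le)

lemma a_v: "k \<in> I \<Longrightarrow> b k \<noteq> 0 \<Longrightarrow> a k \<bullet> v = b k"
  using apices by blast

lemma h_v: "h \<bullet> v < 0"
  using below[OF v a_i_v] a_v[OF j(1)] j(2) by simp

lemma extreme_0_P: "0 extreme_point_of P"
proof (rule extreme_point_cellI[OF A, of "{k \<in> I - {i}. b k = 0}"])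
  show "0 \<in> P" using b_nonneg subspace_0[OF A] by (simp add: cell_def)
  show "x = 0" if "x \<in> A" "\<And>k. k \<in> {k \<in> I - {i}. b k = 0} \<Longrightarrow> a k \<bullet> x = b k" for x
    using that by (intro zero_unique) auto
qed auto

text \<open>The normals at 0 other than that of i still span A, so their constraints force the
  projection to be 0. The tilted hyperplane then singles out height 0 in the fibre over 0, since
  \<open>\<delta>\<close> is positive.\<close>

lemma extreme_0_W: "0 extreme_point_of W"
  unfolding W_def
proof (rule extreme_point_cellI[OF A', of "Some ` {k \<in> I. b k = 0}"])
  show "Some ` {k \<in> I. b k = 0} \<subseteq> K"
    by (auto simp: K_def)
  show "0 \<in> cell A' K a' b'"
    using b_nonneg j(2) subspace_0[OF A] by (simp flip: W_def add: mem_W pr_def)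
  show "a' k \<bullet> 0 = b' k" if "k \<in> Some ` {k \<in> I. b k = 0}" for k
    using that by auto
  fix x assume x: "x \<in> A'" "\<And>k. k \<in> Some ` {k \<in> I. b k = 0} \<Longrightarrow> a' k \<bullet> x = b' k"
  have "a k \<bullet> x = 0" if "k \<in> I - {i}" "b k = 0" for k
  proof -
    have "k \<noteq> j" using that j(2) by auto
    then show ?thesis using x(2)[of "Some k"] that by auto
  qed
  then have "pr x = 0"
    using x(1) by (intro zero_unique) (auto simp: A'_def)
  then have "h \<bullet> x = 0"
    using inner_pr(2)[of x] by simp
  moreover have "h \<bullet> x + \<delta> * (e \<bullet> x) = 0"
    using x(2)[of "Some i"] i by (auto simp: inner_add_left)
  ultimately have "e \<bullet> x = 0"
    using \<delta> by simp
  then show "x = 0" using \<open>pr x = 0\<close> by (simp add: pr_def)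
qed

text \<open>Equality on both top and bottom forces height 0 and slack 0 for facet j; after that the
  constraints tight at v in P determine the point.\<close>

lemma extreme_v_W: "v extreme_point_of W"
  unfolding W_def
proof (rule extreme_point_cellI[OF A', of "insert None (Some ` {k \<in> I. b k \<noteq> 0})"])
  let ?T = "insert None (Some ` {k \<in> I. b k \<noteq> 0})"
  show "?T \<subseteq> K"
    by (auto simp: K_def)
  show "v \<in> cell A' K a' b'"
    using v_P h_v j(1) by (simp flip: W_def add: mem_W pr_A v_A orth_e) (auto simp: cell_def)
  show "a' k \<bullet> v = b' k" if "k \<in> ?T" for k
    using that a_v i j v_A
    by (auto simp: inner_diff_left inner_add_left orth_e a'_def)
  fix x assume x: "x \<in> A'" "\<And>k. k \<in> ?T \<Longrightarrow> a' k \<bullet> x = b' k"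
  have "a j \<bullet> x - e \<bullet> x = b j" "a j \<bullet> x + e \<bullet> x = b j"
    using x(2)[of None] x(2)[of "Some j"] j by (auto simp: inner_diff_left inner_add_left)
  then have ex: "e \<bullet> x = 0" and jx: "a j \<bullet> x = b j" by linarith+
  then have "x \<in> A"
    using x(1) by (simp add: A'_def pr_def)
  moreover have "a k \<bullet> x = b k" if "k \<in> I" "b k \<noteq> 0" for k
    using x(2)[of "Some k"] that jx i(2) by (cases "k = j") (auto simp: a'_def split: if_splits)
  ultimately show "x = v" by (rule v_unique)
qed

section \<open>Boundedness\<close>

text \<open>A point of W projects either into P or, beyond facet i, into the ball of radius
  \<open>\<rho>\<close> given by \<open>near\<close>. Its height is bounded by the slack of facet
  j.\<close>

lemma bounded_W: "bounded W"
proof -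
  obtain B where B: "\<And>x. x \<in> P \<Longrightarrow> norm x \<le> B"
    using bounded by (auto simp: bounded_iff)
  define N where "N = max B \<rho>"
  have "norm p \<le> N + (b j + norm (a j) * N)" if p: "p \<in> W" for p
  proof -
    have pA: "pr p \<in> A"
      using p by (simp add: mem_W)
    have N: "norm (pr p) \<le> N"
    proof (cases "a i \<bullet> p \<le> 0")
      case True
      then have "a k \<bullet> p \<le> b k" if "k \<in> I" for k
        using mem_W_bounds(1)[OF p that] i(2) by (cases "k = i") auto
      then have "pr p \<in> P"
        using pA by (simp add: cell_def)
      then show ?thesis
        using B by (simp add: N_def le_max_iff_disj)
    next
      case False
      then have "norm (pr p) \<le> \<rho>"
      proof (intro near pA)
        show "a k \<bullet> pr p \<le> 0" if "k \<in> I - {i}" "b k = 0" for k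
          using mem_W_bounds(1)[OF p, of k] that by simp
      qed (use mem_W_bounds(3)[OF p] in auto)
      then show ?thesis
        by (simp add: N_def)
    qed
    have "\<bar>e \<bullet> p\<bar> \<le> b j - a j \<bullet> pr p"
      using mem_W_bounds(2)[OF p] by simp
    also have "\<dots> \<le> b j + norm (a j) * norm (pr p)"
      using Cauchy_Schwarz_ineq2[of "a j" "pr p"] by linarith
    also have "\<dots> \<le> b j + norm (a j) * N"
      using N by (intro add_left_mono mult_left_mono) auto
    finally have "norm (pr p) + norm ((e \<bullet> p) *\<^sub>R e) \<le> N + (b j + norm (a j) * N)"
      using N norm_e by simp
    moreover have "norm p \<le> norm (pr p) + norm ((e \<bullet> p) *\<^sub>R e)"
      using norm_triangle_ineq[of "pr p" "(e \<bullet> p) *\<^sub>R e"] by (simp add: pr_def)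
    ultimately show ?thesis by linarith
  qed
  then show ?thesis
    by (auto simp: bounded_iff)
qed

lemma polytope_W: "polytope W"
  using bounded_W polyhedron_cell[OF A' finite_K] by (simp add: polytope_eq_bounded_polyhedron W_def)

section \<open>Irredundancy of the wedge constraints\<close>

text \<open>If all vertices of the face lay in the open half-space where n exceeds its value at x,
  so would their convex hull, which contains x. The functional n serves to steer the vertex off
  facet i or onto it.\<close>

lemma exists_vertex:
  assumes "x \<in> P" "T \<subseteq> I" "\<And>k. k \<in> T \<Longrightarrow> a k \<bullet> x = b k"
  obtains w where "w extreme_point_of P" "\<And>k. k \<in> T \<Longrightarrow> a k \<bullet> w = b k" "n \<bullet> w \<le> n \<bullet> x"
proof -
  let ?F = "{x \<in> P. \<forall>k\<in>T. a k \<bullet> x = b k}"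
  have face: "?F face_of P"
    by (rule face_of_cell[OF A assms(2)])
  have "polytope P"
    using bounded polyhedron_cell[OF A I] by (simp add: polytope_eq_bounded_polyhedron)
  then have F: "compact ?F" "convex ?F"
    using face_of_polytope_polytope[OF _ face] polytope_imp_compact polytope_imp_convex by blast+
  have "\<exists>w. w extreme_point_of ?F \<and> n \<bullet> w \<le> n \<bullet> x"
  proof (rule ccontr)
    assume "\<not> ?thesis"
    then have "{w. w extreme_point_of ?F} \<subseteq> {y. n \<bullet> y > n \<bullet> x}"
      by (auto simp: not_le)
    then have "convex hull {w. w extreme_point_of ?F} \<subseteq> {y. n \<bullet> y > n \<bullet> x}"
      by (intro hull_minimal) (auto simp: convex_halfspace_gt)
    moreover have "x \<in> ?F"
      using assms by simp
    ultimately show False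
      using Krein_Milman_Minkowski[OF F] by auto
  qed
  then obtain w where w: "w extreme_point_of ?F" "n \<bullet> w \<le> n \<bullet> x" by blast
  moreover have "w extreme_point_of P" "w \<in> ?F"
    using w(1) extreme_point_of_face[OF face] by blast+
  ultimately show thesis
    using that by blast
qed

lemma convex_less:
  fixes x y z t :: real
  assumes "x \<le> z" "y < z" "0 < t" "t < 1"
  shows "(1 - t) * x + t * y < z"
proof -
  have "(1 - t) * x \<le> (1 - t) * z"
    using assms by (intro mult_left_mono) auto
  moreover have "t * y < t * z"
    using assms by simp
  moreover have "(1 - t) * z + t * z = z"
    by (simp add: algebra_simps)
  ultimately show ?thesis by linarith
qed

lemma inner_segment: "n \<bullet> (w + t *\<^sub>R (x - w)) = (1 - t) * (n \<bullet> w) + t * (n \<bullet> x)"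
  by (simp add: inner_add_right inner_diff_right algebra_simps)

text \<open>The affine inequality \<open>below\<close> is strict at w, so it survives a short move
  towards x.\<close>

lemma near_vertex:
  assumes w: "w extreme_point_of P" "a i \<bullet> w < 0" and x: "x \<in> A"
  obtains t where "0 < t" "t < 1" "w + t *\<^sub>R (x - w) \<in> A"
    "h \<bullet> (w + t *\<^sub>R (x - w)) + \<delta> * (b j - a j \<bullet> (w + t *\<^sub>R (x - w))) < 0"
proof -
  let ?n = "h - \<delta> *\<^sub>R a j"
  have "?n \<bullet> w < - \<delta> * b j"
    using below[OF w] by (simp add: inner_diff_left algebra_simps)
  then obtain t where t: "t > 0" "t < 1" "?n \<bullet> w + t * (?n \<bullet> (x - w)) < - \<delta> * b j"
    using small_step[of "{()}" "\<lambda>_. ?n \<bullet> w" "\<lambda>_. - \<delta> * b j" "\<lambda>_. ?n \<bullet> (x - w)"] by auto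
  have "w \<in> A"
    using w by (simp add: extreme_point_of_def cell_def)
  then have "w + t *\<^sub>R (x - w) \<in> A"
    using A x by (intro subspace_add subspace_scale subspace_diff)
  then show thesis
    using t by (intro that[of t])
      (simp_all add: inner_diff_left inner_diff_right inner_add_right algebra_simps)
qed

lemma h_less: "h \<bullet> p + \<delta> * (b j - a j \<bullet> p) < 0 \<Longrightarrow> a j \<bullet> p \<le> b j \<Longrightarrow> h \<bullet> p < 0"
  using mult_nonneg_nonneg[of \<delta> "b j - a j \<bullet> p"] \<delta> by linarith

text \<open>The last inequality says that even the top of the fibre over p satisfies the tilted
  constraint strictly. It holds at v by \<open>below\<close>, hence also close to v.\<close>

lemma interior_near_v:
  obtains p where "p \<in> A" "\<And>k. k \<in> I \<Longrightarrow> a k \<bullet> p < b k"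
    "h \<bullet> p + \<delta> * (b j - a j \<bullet> p) < 0"
proof -
  obtain x where x: "x \<in> A" "\<And>k. k \<in> I \<Longrightarrow> a k \<bullet> x < b k"
    using interior by blast
  obtain t where t: "0 < t" "t < 1" "v + t *\<^sub>R (x - v) \<in> A"
    "h \<bullet> (v + t *\<^sub>R (x - v)) + \<delta> * (b j - a j \<bullet> (v + t *\<^sub>R (x - v))) < 0"
    using near_vertex[OF v a_i_v x(1)] by blast
  have "a k \<bullet> (v + t *\<^sub>R (x - v)) < b k" if "k \<in> I" for k
    unfolding inner_segment using v_P x(2) t that by (intro convex_less) (auto simp: cell_def)
  then show thesis
    using that t by blast
qed

lemma lift_W:
  assumes "x \<in> A"
  shows "a' None \<bullet> (x + t *\<^sub>R e) = a j \<bullet> x - t" "a' (Some i) \<bullet> (x + t *\<^sub>R e) = h \<bullet> x + \<delta> * t"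
    "a' (Some j) \<bullet> (x + t *\<^sub>R e) = a j \<bullet> x + t"
    "k \<in> I \<Longrightarrow> k \<noteq> i \<Longrightarrow> k \<noteq> j \<Longrightarrow> a' (Some k) \<bullet> (x + t *\<^sub>R e) = a k \<bullet> x"
  using orth_e[OF assms] by (simp_all add: inner_add_left inner_add_right inner_diff_left)

lemma interior_W: "\<exists>p\<in>A'. \<forall>k\<in>K. a' k \<bullet> p < b' k"
proof -
  obtain p where p: "p \<in> A" "\<And>k. k \<in> I \<Longrightarrow> a k \<bullet> p < b k"
    "h \<bullet> p + \<delta> * (b j - a j \<bullet> p) < 0"
    using interior_near_v by blast
  have "a j \<bullet> p < b j"
    using p(2) j(1) by blast
  then have "h \<bullet> p < 0"
    using h_less[OF p(3)] by simp
  then have "\<forall>k\<in>K. a' k \<bullet> (p + 0 *\<^sub>R e) < b' k"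
    using p(2) \<open>a j \<bullet> p < b j\<close> unfolding ball_K by (simp only: lift_W[OF p(1)] b'_simps i(2)) simp
  then show ?thesis
    using lift_A'[OF p(1)] by blast
qed

lemma irredundant_None_Some_j:
  assumes "k = None \<or> k = Some j"
  shows "\<exists>p\<in>A'. a' k \<bullet> p = b' k \<and> (\<forall>l\<in>K - {k}. a' l \<bullet> p < b' l)"
proof -
  obtain p where p: "p \<in> A" "\<And>k. k \<in> I \<Longrightarrow> a k \<bullet> p < b k"
    "h \<bullet> p + \<delta> * (b j - a j \<bullet> p) < 0"
    using interior_near_v by blast
  have jp: "a j \<bullet> p < b j"
    using p(2) j(1) by blast
  then have hp: "h \<bullet> p < 0"
    using h_less[OF p(3)] by simp
  \<comment> \<open>The height of the lower or upper end of the fibre over p, where constraint k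
    becomes tight.\<close>
  define s where "s = (if k = None then - 1 else 1) * (b j - a j \<bullet> p)"
  have "\<delta> * (b j - a j \<bullet> p) > 0"
    using jp \<delta> by simp
  then have "h \<bullet> p + \<delta> * s < 0"
    using hp p(3) by (auto simp: s_def algebra_simps)
  then have "\<forall>l\<in>K. l \<noteq> k \<longrightarrow> a' l \<bullet> (p + s *\<^sub>R e) < b' l"
    using p(2) jp assms unfolding ball_K by (simp only: lift_W[OF p(1)] b'_simps i(2)) (auto simp: s_def inner_add_right)
  moreover have "a' k \<bullet> (p + s *\<^sub>R e) = b' k"
    using assms by (elim disjE) (simp_all only: lift_W[OF p(1)] b'_simps, simp_all add: s_def)
  ultimately show ?thesis
    using lift_A'[OF p(1), of s] by blast
qed

text \<open>The witness x of facet k in P may violate the tilted constraint. It is moved close to a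
  vertex of facet k that is off facet i, where \<open>below\<close> applies; such a vertex exists
  because \<open>a i\<close> is negative at x.\<close>

lemma irredundant_other:
  assumes k: "k \<in> I" "k \<noteq> i" "k \<noteq> j"
  shows "\<exists>p\<in>A'. a' (Some k) \<bullet> p = b' (Some k) \<and> (\<forall>l\<in>K - {Some k}. a' l \<bullet> p < b' l)"
proof -
  obtain x where x: "x \<in> A" "a k \<bullet> x = b k" "\<And>l. l \<in> I - {k} \<Longrightarrow> a l \<bullet> x < b l"
    using irredundant[OF k(1)] by blast
  have "a l \<bullet> x \<le> b l" if "l \<in> I" for l
    using x(2) x(3)[of l] that by (cases "l = k") auto
  then have xP: "x \<in> P"
    using x(1) by (simp add: cell_def)
  obtain w where w: "w extreme_point_of P" "\<And>l. l \<in> {k} \<Longrightarrow> a l \<bullet> w = b l" "a i \<bullet> w \<le> a i \<bullet> x"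
    by (rule exists_vertex[OF xP, of "{k}" "a i"]) (use k x(2) in auto)
  have ix: "a i \<bullet> x < 0"
    using x(3)[of i] i k by auto
  obtain t where t: "0 < t" "t < 1" "w + t *\<^sub>R (x - w) \<in> A"
    "h \<bullet> (w + t *\<^sub>R (x - w)) + \<delta> * (b j - a j \<bullet> (w + t *\<^sub>R (x - w))) < 0"
    by (rule near_vertex[OF w(1) _ x(1)]) (use w(3) ix in auto)
  let ?p = "w + t *\<^sub>R (x - w)"
  have wP: "w \<in> P"
    using w(1) by (simp add: extreme_point_of_def)
  have less: "a l \<bullet> ?p < b l" if "l \<in> I" "l \<noteq> k" for l
    unfolding inner_segment using wP x(3) t that by (intro convex_less) (auto simp: cell_def)
  have eq: "a k \<bullet> ?p = b k"
    unfolding inner_segment using w(2) x(2) by (simp add: algebra_simps)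
  have jp: "a j \<bullet> ?p < b j"
    using less j(1) k(3) by blast
  then have hp: "h \<bullet> ?p < 0"
    using h_less[OF t(4)] by simp
  have "\<forall>l\<in>K. l \<noteq> Some k \<longrightarrow> a' l \<bullet> (?p + 0 *\<^sub>R e) < b' l"
    using less jp hp unfolding ball_K by (simp only: lift_W[OF t(3)] b'_simps i(2)) auto
  moreover have "a' (Some k) \<bullet> (?p + 0 *\<^sub>R e) = b' (Some k)"
    using eq lift_W(4)[OF t(3) k, of 0] by (simp only: b'_simps)
  ultimately show ?thesis
    using lift_A'[OF t(3), of 0] by blast
qed

text \<open>At half height in the fibre over 0, top and bottom are strict and the tilted constraint
  is violated. Moving the base point slightly inwards makes the other constraints strict too, and
  the segment to an interior point of W crosses the tilted hyperplane.\<close>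

lemma irredundant_Some_i:
  "\<exists>p\<in>A'. a' (Some i) \<bullet> p = b' (Some i) \<and> (\<forall>l\<in>K - {Some i}. a' l \<bullet> p < b' l)"
proof -
  obtain p where p: "p \<in> A'" "\<And>k. k \<in> K \<Longrightarrow> a' k \<bullet> p < b' k"
    using interior_W by blast
  obtain x where x: "x \<in> A" "\<And>k. k \<in> I \<Longrightarrow> a k \<bullet> x < b k"
    using interior by blast
  \<comment> \<open>The Boolean index lists two conditions on t: \<open>True\<close> keeps the
    tilted constraint violated, \<open>False\<close> keeps the top constraint strict.\<close>
  let ?\<alpha> = "\<lambda>c. if c then - (\<delta> * (b j / 2)) else b j / 2"
  let ?\<beta> = "\<lambda>c. if c then - (h \<bullet> x) else a j \<bullet> x"
  have "\<exists>t>0. t < 1 \<and> (\<forall>c\<in>UNIV. ?\<alpha> c + t * ?\<beta> c < (if c then 0 else b j))"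
    by (rule small_step) (use \<delta> j(2) in auto)
  then obtain t where t0: "0 < t" "t < 1" "\<And>c. ?\<alpha> c + t * ?\<beta> c < (if c then 0 else b j)"
    by auto
  note t = t0(1,2) t0(3)[of True, simplified] t0(3)[of False, simplified]
  define q where "q = t *\<^sub>R x + (b j / 2) *\<^sub>R e"
  have tx: "t *\<^sub>R x \<in> A"
    using A x(1) by (rule subspace_scale)
  have ak: "a k \<bullet> (t *\<^sub>R x) < b k" if "k \<in> I" for k
    using convex_less[of 0 "b k" "a k \<bullet> x" t] b_nonneg x(2) that t by simp
  have q: "\<forall>l\<in>K. l \<noteq> Some i \<longrightarrow> a' l \<bullet> q < b' l"
    using ak[OF j(1)] ak t j unfolding ball_K q_def
    by (simp only: lift_W[OF tx] b'_simps) (auto simp: inner_add_right)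
  have Hq: "a' (Some i) \<bullet> q > 0"
    using t(3) unfolding q_def by (simp only: lift_W[OF tx]) simp
  have Hp: "a' (Some i) \<bullet> p < 0"
    using p(2)[of "Some i"] i by (simp add: K_def)
  define s where "s = - (a' (Some i) \<bullet> p) / (a' (Some i) \<bullet> q - a' (Some i) \<bullet> p)"
  have s: "0 < s" "s < 1" "a' (Some i) \<bullet> p + s * (a' (Some i) \<bullet> q - a' (Some i) \<bullet> p) = 0"
    using Hp Hq by (auto simp: s_def divide_simps simp del: a'_simps)
  have "a' (Some i) \<bullet> (p + s *\<^sub>R (q - p)) = 0"
    using s(3) unfolding inner_segment by (simp add: algebra_simps del: a'_simps)
  moreover have "a' l \<bullet> (p + s *\<^sub>R (q - p)) < b' l" if "l \<in> K - {Some i}" for l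
    unfolding inner_segment using p(2)[of l] q that s by (intro convex_less) auto
  moreover have "p + s *\<^sub>R (q - p) \<in> A'"
    using A' p(1) lift_A'[OF tx, of "b j / 2", folded q_def] by (intro subspace_add subspace_scale subspace_diff)
  ultimately show ?thesis
    using i(2) by (intro bexI[of _ "p + s *\<^sub>R (q - p)"]) (auto simp del: a'_simps)
qed

lemma irredundant_W:
  assumes "k \<in> K"
  shows "\<exists>p\<in>A'. a' k \<bullet> p = b' k \<and> (\<forall>l\<in>K - {k}. a' l \<bullet> p < b' l)"
  using assms irredundant_None_Some_j[of k] irredundant_Some_i irredundant_other
  unfolding K_def by blast

section \<open>Dimension, facets and the spindle property\<close>

lemma facets_W: "affine hull W = A'"
    "polytope_facets W = (\<lambda>k. W \<inter> {x. a' k \<bullet> x = b' k}) ` K"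
    "card (polytope_facets W) = Suc (card I)"
proof -
  obtain p where p: "p \<in> A'" "\<And>k. k \<in> K \<Longrightarrow> a' k \<bullet> p < b' k"
    using interior_W by blast
  note * = facets_of_cell[OF A' finite_K p irredundant_W, folded W_def]
  show "affine hull W = A'"
    by (rule *(1))
  show "polytope_facets W = (\<lambda>k. W \<inter> {x. a' k \<bullet> x = b' k}) ` K"
    by (rule *(2))
  show "card (polytope_facets W) = Suc (card I)"
    using *(3) card_K by simp
qed

lemma aff_dim_W: "aff_dim W = int (dim A) + 1"
  using aff_dim_affine_hull[of W] by (simp add: facets_W(1) aff_dim_subspace A' dim_A')

lemma spindle_W: "spindle W 0 v"
proof -
  have "(0 \<in> F) \<noteq> (v \<in> F)" if F: "F \<in> polytope_facets W" for F
  proof -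
    obtain k where k: "k \<in> K" "F = W \<inter> {x. a' k \<bullet> x = b' k}"
      using F facets_W(2) by blast
    \<comment> \<open>Constraint k is tight at 0 iff \<open>b' k = 0\<close>, so this says that
      every constraint is tight at exactly one of the apices.\<close>
    have "\<forall>k\<in>K. (b' k = 0) \<noteq> (a' k \<bullet> v = b' k)"
    proof (unfold ball_K, intro conjI ballI impI)
      show "(b' None = 0) \<noteq> (a' None \<bullet> v = b' None)" "(b' (Some j) = 0) \<noteq> (a' (Some j) \<bullet> v = b' (Some j))"
        using j(2) a_v[OF j(1)] orth_e[OF v_A] by (simp_all add: inner_diff_left inner_add_left)
      show "(b' (Some i) = 0) \<noteq> (a' (Some i) \<bullet> v = b' (Some i))"
        using i(2) h_v orth_e[OF v_A] by (simp add: inner_add_left)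
    qed (use apices in simp)
    moreover have "0 \<in> W" "v \<in> W"
      using extreme_0_W extreme_v_W by (auto simp: extreme_point_of_def)
    ultimately show ?thesis
      using k by auto
  qed
  moreover have "v \<noteq> 0"
    using a_i_v by auto
  ultimately show ?thesis
    using polytope_W extreme_0_W extreme_v_W by (auto simp: spindle_def polytope_vertices_def)
qed

section \<open>Contraction of the wedge onto the graph of P\<close>

text \<open>Away from the points beyond facet \<open>i\<close>, \<open>\<phi> z\<close> is a vertex of the smallest face of \<open>P\<close> containing the
  projection of \<open>z\<close>, taken in facet \<open>i\<close> if \<open>z\<close> lies on the tilted facet.\<close>

definition \<phi> :: "'a \<Rightarrow> 'a" where
  "\<phi> z = (if 0 \<le> a i \<bullet> z then 0
     else SOME w. w extreme_point_of P \<and> (\<forall>k\<in>I - {i}. a k \<bullet> z = b k \<longrightarrow> a k \<bullet> w = b k) \<and>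
       (h \<bullet> z + \<delta> * (e \<bullet> z) = 0 \<longrightarrow> a i \<bullet> w = 0))"

lemma \<phi>_0: "0 \<le> a i \<bullet> z \<Longrightarrow> \<phi> z = 0"
  by (simp add: \<phi>_def)

text \<open>If z lies on or beyond facet i, \<open>near\<close> and \<open>\<rho>\<close> ensure
  that only constraints through 0 can be tight at z among those of P, so 0 serves. Otherwise the
  projection lies in P and \<open>exists_vertex\<close> applies.\<close>

lemma \<phi>_spec:
  assumes z: "z \<in> W"
  shows "\<phi> z extreme_point_of P" "\<And>k. k \<in> I \<Longrightarrow> k \<noteq> i \<Longrightarrow> a k \<bullet> z = b k \<Longrightarrow> a k \<bullet> \<phi> z = b k"
    "h \<bullet> z + \<delta> * (e \<bullet> z) = 0 \<Longrightarrow> a i \<bullet> \<phi> z = 0"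
proof -
  let ?Q = "\<lambda>w. w extreme_point_of P \<and> (\<forall>k\<in>I - {i}. a k \<bullet> z = b k \<longrightarrow> a k \<bullet> w = b k) \<and>
      (h \<bullet> z + \<delta> * (e \<bullet> z) = 0 \<longrightarrow> a i \<bullet> w = 0)"
  have zA: "pr z \<in> A"
    using z by (simp add: mem_W)
  have "?Q (\<phi> z)"
  proof (cases "0 \<le> a i \<bullet> z")
    case True
    have "norm (pr z) \<le> \<rho>"
    proof (intro near zA)
      show "a k \<bullet> pr z \<le> 0" if "k \<in> I - {i}" "b k = 0" for k
        using mem_W_bounds(1)[OF z, of k] that by simp
    qed (use mem_W_bounds(3)[OF z] True in auto)
    have "b k = 0" if k: "k \<in> I" "a k \<bullet> z = b k" for k
    proof (rule ccontr)
      assume "b k \<noteq> 0"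
      then have "norm (a k) * \<rho> < b k"
        using \<rho>[OF k(1)] b_nonneg[OF k(1)] by simp
      moreover have "a k \<bullet> pr z \<le> norm (a k) * norm (pr z)"
        by (rule norm_cauchy_schwarz)
      moreover have "norm (a k) * norm (pr z) \<le> norm (a k) * \<rho>"
        using \<open>norm (pr z) \<le> \<rho>\<close> by (intro mult_left_mono) auto
      ultimately show False using k by simp
    qed
    then show ?thesis
      using extreme_0_P True by (simp add: \<phi>_def)
  next
    case False
    have "a k \<bullet> pr z \<le> b k" if "k \<in> I" for k
      using mem_W_bounds(1)[OF z that] False i(2) that by (cases "k = i") auto
    then have zP: "pr z \<in> P"
      using zA by (simp add: cell_def)
    \<comment> \<open>Where this functional is no larger than at z,
      \<open>h \<bullet> x + \<delta> * (b j - a j \<bullet> x)\<close> is no smaller. For z on the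
      tilted facet that quantity is nonnegative at z, whereas \<open>below\<close> makes it negative
      at vertices off facet i; so the vertex found lies on facet i.\<close>
    let ?n = "\<delta> *\<^sub>R a j - h"
    obtain w where w: "w extreme_point_of P" "\<And>k. k \<in> {k \<in> I - {i}. a k \<bullet> z = b k} \<Longrightarrow> a k \<bullet> w = b k"
      "?n \<bullet> w \<le> ?n \<bullet> pr z"
      by (rule exists_vertex[OF zP, of "{k \<in> I - {i}. a k \<bullet> z = b k}" ?n]) auto
    have "a i \<bullet> w = 0" if H: "h \<bullet> z + \<delta> * (e \<bullet> z) = 0"
    proof (rule ccontr)
      assume "a i \<bullet> w \<noteq> 0"
      moreover have "a i \<bullet> w \<le> 0"
        using w(1) i by (auto simp: extreme_point_of_def cell_def)
      ultimately have "h \<bullet> w + \<delta> * (b j - a j \<bullet> w) < 0"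
        using below[OF w(1)] by simp
      then have "h \<bullet> z + \<delta> * (b j - a j \<bullet> z) < 0"
        using w(3) by (simp add: inner_diff_left algebra_simps)
      moreover have "\<delta> * (e \<bullet> z) \<le> \<delta> * (b j - a j \<bullet> z)"
        using mem_W_bounds(2)[OF z] \<delta> by (intro mult_left_mono) auto
      ultimately show False using H by linarith
    qed
    then have "?Q w"
      using w by auto
    then have "?Q (SOME w. ?Q w)"
      by (rule someI)
    then show ?thesis
      using False by (simp add: \<phi>_def)
  qed
  then show "\<phi> z extreme_point_of P" "\<And>k. k \<in> I \<Longrightarrow> k \<noteq> i \<Longrightarrow> a k \<bullet> z = b k \<Longrightarrow> a k \<bullet> \<phi> z = b k"
    "h \<bullet> z + \<delta> * (e \<bullet> z) = 0 \<Longrightarrow> a i \<bullet> \<phi> z = 0"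
    by auto
qed

lemma \<phi>_v: "\<phi> v = v"
proof (rule v_unique)
  have vW: "v \<in> W"
    using extreme_v_W by (simp add: extreme_point_of_def)
  show "\<phi> v \<in> A"
    using \<phi>_spec(1)[OF vW] by (simp add: extreme_point_of_def cell_def)
  show "a k \<bullet> \<phi> v = b k" if "k \<in> I" "b k \<noteq> 0" for k
    using \<phi>_spec(2)[OF vW that(1)] a_v[OF that] that i(2) by auto
qed

text \<open>\<open>edge_cell_direction\<close> in wedge coordinates: \<open>d\<close> is the
  horizontal part of a direction and \<open>\<tau>\<close> its height.\<close>

lemma edge_W_direction:
  assumes E: "E edge_of W" "z \<in> E" "z' \<in> E" "z \<noteq> z'" and d: "d \<in> A"
    and tight: "\<And>k. k \<in> I \<Longrightarrow> k \<noteq> i \<Longrightarrow> a k \<bullet> z = b k \<Longrightarrow> a k \<bullet> z' = b k \<Longrightarrow> a k \<bullet> d = 0"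
    and top: "a j \<bullet> z + e \<bullet> z = b j \<Longrightarrow> a j \<bullet> z' + e \<bullet> z' = b j \<Longrightarrow> a j \<bullet> d + \<tau> = 0"
    and bottom: "a j \<bullet> z - e \<bullet> z = b j \<Longrightarrow> a j \<bullet> z' - e \<bullet> z' = b j \<Longrightarrow> a j \<bullet> d - \<tau> = 0"
    and tilted: "h \<bullet> z + \<delta> * (e \<bullet> z) = 0 \<Longrightarrow> h \<bullet> z' + \<delta> * (e \<bullet> z') = 0 \<Longrightarrow> h \<bullet> d + \<delta> * \<tau> = 0"
  shows "\<exists>c. d + \<tau> *\<^sub>R e = c *\<^sub>R (z' - z)"
proof -
  have "\<forall>k\<in>K. a' k \<bullet> z = b' k \<longrightarrow> a' k \<bullet> z' = b' k \<longrightarrow> a' k \<bullet> (d + \<tau> *\<^sub>R e) = 0"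
  proof (unfold ball_K, intro conjI ballI impI)
    show "a' None \<bullet> (d + \<tau> *\<^sub>R e) = 0" if "a' None \<bullet> z = b' None" "a' None \<bullet> z' = b' None"
      using bottom that by (simp only: lift_W[OF d]) (simp add: inner_diff_left)
    show "a' (Some i) \<bullet> (d + \<tau> *\<^sub>R e) = 0" if "a' (Some i) \<bullet> z = b' (Some i)" "a' (Some i) \<bullet> z' = b' (Some i)"
      using tilted that i(2) by (simp only: lift_W[OF d]) (simp add: inner_add_left)
    show "a' (Some j) \<bullet> (d + \<tau> *\<^sub>R e) = 0" if "a' (Some j) \<bullet> z = b' (Some j)" "a' (Some j) \<bullet> z' = b' (Some j)"
      using top that by (simp only: lift_W[OF d]) (simp add: inner_add_left)
    show "a' (Some k) \<bullet> (d + \<tau> *\<^sub>R e) = 0" if "k \<in> I" "k \<noteq> i" "k \<noteq> j"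
      "a' (Some k) \<bullet> z = b' (Some k)" "a' (Some k) \<bullet> z' = b' (Some k)" for k
      using tight[of k] that by (simp add: inner_add_right)
  qed
  then show ?thesis
    using edge_cell_direction[OF A' finite_K E(1)[unfolded W_def] E(2-4) lift_A'[OF d]] by blast
qed

text \<open>Here \<open>D\<close> is the direction space of the constraints (other than \<open>i\<close>) tight along the edge; lifting its elements to directions along
  the edge shows \<open>dim D \<le> 1\<close>, or \<open>dim D \<le> 2\<close> if the edge lies on the tilted facet. In the
  latter case constraint \<open>i\<close> reduces the dimension by one.\<close>

lemma polytope_adj_\<phi>:
  assumes "polytope_adj W z z'"
  shows "\<phi> z = \<phi> z' \<or> polytope_adj P (\<phi> z) (\<phi> z')"
proof (cases "\<phi> z = \<phi> z'")
  case False
  obtain E where E: "E edge_of W" "z \<in> E" "z' \<in> E" "z \<noteq> z'"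
    using assms by (auto simp: polytope_adj_def)
  have zW: "z \<in> W" "z' \<in> W"
    using E edge_of_imp_subset by blast+
  note \<phi>z = \<phi>_spec[OF zW(1)] and \<phi>z' = \<phi>_spec[OF zW(2)]
  have vert: "\<phi> z \<in> polytope_vertices P" "\<phi> z' \<in> polytope_vertices P"
    using \<phi>z(1) \<phi>z'(1) by (auto simp: polytope_vertices_def)
  have \<phi>P: "\<phi> z \<in> P" "\<phi> z' \<in> P"
    using \<phi>z(1) \<phi>z'(1) by (auto simp: extreme_point_of_def)
  define T where "T = {k \<in> I - {i}. a k \<bullet> z = b k \<and> a k \<bullet> z' = b k}"
  define D where "D = {d \<in> A. \<forall>k\<in>T. a k \<bullet> d = 0}"
  have \<phi>T: "a k \<bullet> \<phi> z = b k" "a k \<bullet> \<phi> z' = b k" if "k \<in> T" for k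
    using that \<phi>z(2) \<phi>z'(2) by (auto simp: T_def)
  have D_diff: "x - \<phi> z \<in> D" if "x \<in> A" "\<And>k. k \<in> T \<Longrightarrow> a k \<bullet> x = b k" for x
    using that \<phi>P(1) \<phi>T A by (auto simp: D_def cell_def inner_diff_right subspace_diff)
  let ?H = "\<lambda>z. h \<bullet> z + \<delta> * (e \<bullet> z) = 0"
  \<comment> \<open>\<open>\<sigma> \<bullet> d\<close> is the height given to the lift of d: the
    value that keeps it on the top or the bottom of the wedge if the edge lies there, and 0
    otherwise.\<close>
  define \<sigma> where "\<sigma> = (if a j \<bullet> z + e \<bullet> z = b j \<and> a j \<bullet> z' + e \<bullet> z' = b j then - a j
    else if a j \<bullet> z - e \<bullet> z = b j \<and> a j \<bullet> z' - e \<bullet> z' = b j then a j else 0)"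
  have line: "d \<in> span {pr z' - pr z}" if d: "d \<in> D" and H: "?H z \<Longrightarrow> ?H z' \<Longrightarrow> h \<bullet> d + \<delta> * (\<sigma> \<bullet> d) = 0" for d
  proof -
    have dA: "d \<in> A" and dT: "\<And>k. k \<in> T \<Longrightarrow> a k \<bullet> d = 0"
      using d by (auto simp: D_def)
    have "\<exists>c. d + (\<sigma> \<bullet> d) *\<^sub>R e = c *\<^sub>R (z' - z)"
    proof (rule edge_W_direction[OF E dA])
      show "a k \<bullet> d = 0" if "k \<in> I" "k \<noteq> i" "a k \<bullet> z = b k" "a k \<bullet> z' = b k" for k
        using dT that by (auto simp: T_def)
      show "a j \<bullet> d - \<sigma> \<bullet> d = 0" if bot: "a j \<bullet> z - e \<bullet> z = b j" "a j \<bullet> z' - e \<bullet> z' = b j"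
      proof (cases "a j \<bullet> z + e \<bullet> z = b j \<and> a j \<bullet> z' + e \<bullet> z' = b j")
        \<comment> \<open>An edge on both top and bottom has j among its tight constraints, so the
          two prescribed heights agree.\<close>
        case True
        then have "a j \<bullet> z = b j" "a j \<bullet> z' = b j"
          using bot by linarith+
        then have "a j \<bullet> d = 0"
          using j(1) dT by (auto simp: T_def)
        then show ?thesis
          by (simp add: \<sigma>_def)
      qed (use bot in \<open>auto simp: \<sigma>_def\<close>)
    qed (use H in \<open>auto simp: \<sigma>_def\<close>)
    then obtain c where "d + (\<sigma> \<bullet> d) *\<^sub>R e = c *\<^sub>R (z' - z)" ..
    then have "pr (d + (\<sigma> \<bullet> d) *\<^sub>R e) = c *\<^sub>R (pr z' - pr z)"
      by (simp only: linear_scale[OF pr_linear] linear_diff[OF pr_linear])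
    then show ?thesis
      using dA by (simp add: span_base span_scale)
  qed
  show ?thesis
  proof (cases "?H z \<and> ?H z'")
    case nH: False
    let ?G = "{x \<in> P. \<forall>k\<in>T. a k \<bullet> x = b k}"
    have "?G face_of P"
      by (rule face_of_cell[OF A]) (auto simp: T_def)
    moreover have "dim (span {pr z' - pr z}) \<le> 1"
      using dim_le_card[of _ "{pr z' - pr z}"] by force
    moreover have "x - \<phi> z \<in> span {pr z' - pr z}" if "x \<in> ?G" for x
      using that nH by (intro line D_diff) (auto simp: cell_def)
    ultimately have "polytope_adj P (\<phi> z) (\<phi> z')"
      using \<phi>P \<phi>T False vert
      by (intro polytope_adjI[of ?G _ _ _ "span {pr z' - pr z}"]) auto
    then show ?thesis ..
  next
    case H: True
    let ?G = "{x \<in> P. \<forall>k\<in>insert i T. a k \<bullet> x = b k}"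
    let ?D = "{d \<in> D. a i \<bullet> d = 0}"
    have \<phi>i: "a i \<bullet> \<phi> z = 0" "a i \<bullet> \<phi> z' = 0"
      using H \<phi>z(3) \<phi>z'(3) by auto
    \<comment> \<open>If \<open>a i\<close> vanished at both ends, both would be sent to 0. This
      provides a direction in D that leaves facet i and makes the later inclusion strict.\<close>
    have "a i \<bullet> z \<noteq> 0 \<or> a i \<bullet> z' \<noteq> 0"
      using False \<phi>_0 by force
    moreover have "pr z - \<phi> z \<in> D" "pr z' - \<phi> z \<in> D"
      using zW by (auto intro!: D_diff simp: mem_W T_def)
    moreover have "a i \<bullet> (pr z - \<phi> z) = a i \<bullet> z" "a i \<bullet> (pr z' - \<phi> z) = a i \<bullet> z'"
      using \<phi>i by (simp_all add: inner_diff_right)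
    ultimately obtain d1 where d1: "d1 \<in> D" "a i \<bullet> d1 \<noteq> 0"
      by metis
    have D: "subspace D"
      using A by (auto simp: D_def subspace_def inner_add_right)
    then have D2: "subspace ?D"
      by (auto simp: subspace_def inner_add_right)
    \<comment> \<open>By \<open>line\<close>, the kernel in D of the functional
      \<open>h \<bullet> d + \<delta> * (\<sigma> \<bullet> d)\<close> lies in a line. A kernel has
      codimension at most one, so two vectors suffice to span D.\<close>
    have "\<exists>d2. D \<subseteq> span {pr z' - pr z, d2}"
    proof (cases "\<exists>d2\<in>D. h \<bullet> d2 + \<delta> * (\<sigma> \<bullet> d2) \<noteq> 0")
      case True
      then obtain d2 where d2: "d2 \<in> D" "h \<bullet> d2 + \<delta> * (\<sigma> \<bullet> d2) \<noteq> 0" by blast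
      have "d \<in> span {pr z' - pr z, d2}" if d: "d \<in> D" for d
      proof -
        define s where "s = (h \<bullet> d + \<delta> * (\<sigma> \<bullet> d)) / (h \<bullet> d2 + \<delta> * (\<sigma> \<bullet> d2))"
        have "s * (h \<bullet> d2 + \<delta> * (\<sigma> \<bullet> d2)) = h \<bullet> d + \<delta> * (\<sigma> \<bullet> d)"
          using d2(2) by (simp add: s_def)
        then have "d - s *\<^sub>R d2 \<in> span {pr z' - pr z}"
          using d d2(1) D by (intro line subspace_diff subspace_scale)
            (simp_all add: inner_diff_right algebra_simps)
        then have "d - s *\<^sub>R d2 \<in> span {pr z' - pr z, d2}"
          using span_mono[of "{pr z' - pr z}" "{pr z' - pr z, d2}"] by blast
        moreover have "s *\<^sub>R d2 \<in> span {pr z' - pr z, d2}"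
          by (intro span_scale span_base) simp
        ultimately have "(d - s *\<^sub>R d2) + s *\<^sub>R d2 \<in> span {pr z' - pr z, d2}"
          by (rule span_add)
        then show ?thesis by simp
      qed
      then show ?thesis by blast
    next
      case False
      then have "D \<subseteq> span {pr z' - pr z, 0}"
        using line span_mono[of "{pr z' - pr z}" "{pr z' - pr z, 0}"] by blast
      then show ?thesis ..
    qed
    then obtain d2 where "D \<subseteq> span {pr z' - pr z, d2}" ..
    then have "dim D \<le> card {pr z' - pr z, d2}"
      by (intro dim_le_card) auto
    then have "dim D \<le> 2"
      using card_insert_le_m1[of 2 "{d2}" "pr z' - pr z"] by simp
    moreover have "dim ?D < dim D"
    proof (rule dim_psubset)
      have "?D \<subset> D" using d1 by blast
      then show "span ?D \<subset> span D"
        using D D2 by (simp only: span_eq_iff[THEN iffD2])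
    qed
    ultimately have "dim ?D \<le> 1"
      by simp
    moreover have "?G face_of P"
      by (rule face_of_cell[OF A]) (use i in \<open>auto simp: T_def\<close>)
    moreover have "x - \<phi> z \<in> ?D" if "x \<in> ?G" for x
      using that D_diff[of x] \<phi>i i(2) by (auto simp: cell_def inner_diff_right)
    ultimately have "polytope_adj P (\<phi> z) (\<phi> z')"
      using \<phi>P \<phi>T \<phi>i i(2) False vert by (intro polytope_adjI[of ?G _ _ _ ?D]) auto
    then show ?thesis ..
  qed
qed simp

text \<open>The apex \<open>0\<close> of \<open>W\<close> lies on neither of the two facets that replace facet \<open>j\<close> of \<open>P\<close>.
  This costs every path from \<open>0\<close> a first step that makes no progress in \<open>P\<close>.\<close>

lemma polytope_adj_zero_\<phi>:
  assumes "polytope_adj W 0 z"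
  shows "\<phi> z = 0"
proof (cases "0 \<le> a i \<bullet> z")
  case True
  then show ?thesis by (rule \<phi>_0)
next
  case False
  obtain E where E: "E edge_of W" "0 \<in> E" "z \<in> E" "0 \<noteq> z"
    using assms by (auto simp: polytope_adj_def)
  have zW: "z \<in> W"
    using E edge_of_imp_subset by blast
  show ?thesis
  proof (cases "h \<bullet> z + \<delta> * (e \<bullet> z) = 0")
    case nH: False
    \<comment> \<open>The vertical direction is compatible with all constraints tight along the
      edge: top and bottom miss 0 as \<open>b j > 0\<close>, and the tilted facet misses z. So the
      edge is vertical and z projects to 0, contrary to \<open>a i \<bullet> z < 0\<close>.\<close>
    have "\<exists>c. 0 + 1 *\<^sub>R e = c *\<^sub>R (z - 0)"
      by (rule edge_W_direction[OF E]) (use nH j(2) subspace_0[OF A] in auto)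
    then obtain c where c: "e = c *\<^sub>R z"
      by auto
    then have "c *\<^sub>R pr z = 0"
      using pr_e linear_scale[OF pr_linear] by metis
    moreover have "c \<noteq> 0"
      using c norm_e by auto
    ultimately have "pr z = 0"
      by simp
    then have "a i \<bullet> z = 0"
      using inner_pr(4)[of z] by simp
    then show ?thesis
      using False by simp
  next
    case H: True
    \<comment> \<open>This height puts the lift of \<open>\<phi> z\<close> on the tilted hyperplane.
      The lift is then parallel to the edge, so \<open>\<phi> z\<close> is a multiple of the
      projection of z; as \<open>a i\<close> vanishes at the former but not at the latter, the
      factor is 0.\<close>
    define \<tau> where "\<tau> = - (h \<bullet> \<phi> z) / \<delta>"
    have \<phi>A: "\<phi> z \<in> A"
      using \<phi>_spec(1)[OF zW] by (simp add: extreme_point_of_def cell_def)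
    have "\<exists>c. \<phi> z + \<tau> *\<^sub>R e = c *\<^sub>R (z - 0)"
      by (rule edge_W_direction[OF E \<phi>A]) (use \<phi>_spec(2)[OF zW] j(2) \<delta> in \<open>auto simp: \<tau>_def\<close>)
    then obtain c where c: "\<phi> z + \<tau> *\<^sub>R e = c *\<^sub>R z"
      by auto
    then have "pr (\<phi> z + \<tau> *\<^sub>R e) = c *\<^sub>R pr z"
      by (simp only: linear_scale[OF pr_linear])
    then have \<phi>c: "\<phi> z = c *\<^sub>R pr z"
      using \<phi>A by simp
    then have "c * (a i \<bullet> z) = 0"
      using \<phi>_spec(3)[OF zW H] by simp
    then show ?thesis
      using False \<phi>c by simp
  qed
qed

lemma graph_dist_W: "graph_dist P 0 v + 1 \<le> graph_dist W 0 v"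
proof -
  have "graph_dist P (\<phi> 0) (\<phi> v) + 1 \<le> graph_dist W 0 v"
  proof (rule graph_dist_image_Suc_le)
    show "\<phi> z \<in> polytope_vertices P" if "z \<in> polytope_vertices W" for z
      using that \<phi>_spec(1) by (simp add: polytope_vertices_def extreme_point_of_def)
    show "\<phi> z = \<phi> 0" if "polytope_adj W 0 z" for z
      using polytope_adj_zero_\<phi>[OF that] by (simp add: \<phi>_0)
    show "0 \<noteq> v"
      using a_i_v by auto
  qed (rule polytope_adj_\<phi>)
  then show ?thesis
    by (simp add: \<phi>_0 \<phi>_v)
qed

end

subsection \<open>Iterating the construction\<close>

lemma spindle_facet_representation:
  fixes P :: "'a::euclidean_space set"
  assumes "spindle P 0 v" "aff_dim P = int d"
  obtains A a b where "subspace A" "dim A = d" "finite (polytope_facets P)"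
    and "\<And>F. F \<in> polytope_facets P \<Longrightarrow> a F \<in> A"
    and "\<And>F x. F \<in> polytope_facets P \<Longrightarrow> x \<in> P \<Longrightarrow> x \<in> F \<longleftrightarrow> a F \<bullet> x = b F"
    and "P = cell A (polytope_facets P) a b"
    and "\<exists>p\<in>A. \<forall>F\<in>polytope_facets P. a F \<bullet> p < b F"
    and "\<And>F. F \<in> polytope_facets P \<Longrightarrow>
           \<exists>p\<in>A. a F \<bullet> p = b F \<and> (\<forall>G\<in>polytope_facets P - {F}. a G \<bullet> p < b G)"
proof -
  have P: "polytope P" "0 \<in> P"
    using assms(1) by (auto simp: spindle_def polytope_vertices_def extreme_point_of_def)
  have hull: "affine hull P = span P"
    using P(2) by (intro affine_hull_span_0 hull_inc)
  then have "aff_dim P = int (dim (span P))"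
    using aff_dim_affine_hull[of P] by (simp add: aff_dim_subspace)
  then have dim: "dim (span P) = d"
    using assms(2) by simp
  show thesis
  proof (rule facet_representation[OF polytope_imp_polyhedron[OF P(1)] _ hull subspace_span])
    show "P \<noteq> {}" using P(2) by blast
  next
    fix a b
    assume *: "finite (polytope_facets P)" "\<And>F. F \<in> polytope_facets P \<Longrightarrow> a F \<in> span P"
      "\<And>F. F \<in> polytope_facets P \<Longrightarrow> F = P \<inter> {x. a F \<bullet> x = b F}"
      "P = cell (span P) (polytope_facets P) a b"
      "\<exists>p\<in>span P. \<forall>F\<in>polytope_facets P. a F \<bullet> p < b F"
      "\<And>F. F \<in> polytope_facets P \<Longrightarrow>
           \<exists>p\<in>span P. a F \<bullet> p = b F \<and> (\<forall>G\<in>polytope_facets P - {F}. a G \<bullet> p < b G)"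
    have "x \<in> F \<longleftrightarrow> a F \<bullet> x = b F" if "F \<in> polytope_facets P" "x \<in> P" for F x
      using *(3)[OF that(1)] that(2) by (metis (mono_tags, lifting) Int_iff mem_Collect_eq)
    then show thesis
      using that[OF subspace_span dim *(1,2) _ *(4-6)] by blast
  qed
qed

section \<open>Size of the tilt\<close>

text \<open>\<open>\<eta>\<close> keeps h negative on Z, \<open>\<rho>\<close> keeps the ball away
  from the facets missing 0, and \<open>\<delta>\<close> is chosen last, against both. Where the
  constraints in V hold and \<open>a i\<close> is nonnegative, h is at least
  \<open>\<eta> / R\<close> times the norm, while the tilted constraint allows at most
  \<open>\<delta>\<close> times the slack of j.\<close>

lemma tilt_parameters:
  fixes a :: "'k \<Rightarrow> 'a::euclidean_space" and Z :: "'a set"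
  assumes finite: "finite I" "finite V" "finite Z" and "R > 0"
    and R: "\<forall>x\<in>A. norm x \<le> R * (\<Sum>k\<in>V. \<bar>a k \<bullet> x\<bar>)"
    and Z: "\<forall>w\<in>Z. a i \<bullet> w < 0"
  shows "\<exists>\<eta> \<delta> \<rho> :: real. \<delta> > 0 \<and>
    (\<forall>w\<in>Z. (a i - \<eta> *\<^sub>R (\<Sum>k\<in>V. a k)) \<bullet> w + \<delta> * (b j - a j \<bullet> w) < 0) \<and>
    (\<forall>x\<in>A. (\<forall>k\<in>V. a k \<bullet> x \<le> 0) \<longrightarrow> 0 \<le> a i \<bullet> x \<longrightarrow>
       (a i - \<eta> *\<^sub>R (\<Sum>k\<in>V. a k)) \<bullet> x \<le> \<delta> * (b j - a j \<bullet> x) \<longrightarrow> norm x \<le> \<rho>) \<and>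
    (\<forall>k\<in>I. 0 < b k \<longrightarrow> norm (a k) * \<rho> < b k)"
proof -
  let ?s = "\<Sum>k\<in>V. a k"
  obtain \<eta> where \<eta>: "\<eta> > 0" "\<And>w. w \<in> Z \<Longrightarrow> a i \<bullet> w + \<eta> * - (?s \<bullet> w) < 0"
    using small_step[OF finite(3), of "\<lambda>w. a i \<bullet> w" "\<lambda>_. 0" "\<lambda>w. - (?s \<bullet> w)"] Z by blast
  define h where "h = a i - \<eta> *\<^sub>R ?s"
  have hZ: "h \<bullet> w < 0" if "w \<in> Z" for w
    using \<eta>(2)[OF that] by (simp add: h_def inner_diff_left)
  have "\<exists>t>0. t < 1 \<and> (\<forall>k\<in>{k \<in> I. 0 < b k}. 0 + t * norm (a k) < b k)"
    by (rule small_step) (use finite(1) in auto)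
  then obtain \<rho> where "\<rho> > 0" "\<forall>k\<in>{k \<in> I. 0 < b k}. 0 + \<rho> * norm (a k) < b k"
    by blast
  then have \<rho>: "\<rho> > 0" "\<And>k. k \<in> I \<Longrightarrow> 0 < b k \<Longrightarrow> norm (a k) * \<rho> < b k"
    by (auto simp: mult.commute)
  obtain \<delta>1 where \<delta>1: "\<delta>1 > 0" "\<And>w. w \<in> Z \<Longrightarrow> h \<bullet> w + \<delta>1 * \<bar>b j - a j \<bullet> w\<bar> < 0"
    using small_step[OF finite(3), of "\<lambda>w. h \<bullet> w" "\<lambda>_. 0" "\<lambda>w. \<bar>b j - a j \<bullet> w\<bar>"] hZ by blast
  \<comment> \<open>\<open>\<delta>2\<close> lets the term proportional to \<open>norm x\<close> be
    absorbed into half of \<open>\<eta> * norm x\<close>, and \<open>\<delta>3\<close> keeps the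
    constant term below half of \<open>\<eta> * \<rho>\<close>.\<close>
  obtain \<delta>2 where \<delta>2: "\<delta>2 > 0" "\<delta>2 * (R * norm (a j)) < \<eta> / 2"
    using small_step[of "{()}" "\<lambda>_. 0" "\<lambda>_. \<eta> / 2" "\<lambda>_. R * norm (a j)"] \<eta>(1) by auto
  obtain \<delta>3 where \<delta>3: "\<delta>3 > 0" "\<delta>3 * (R * \<bar>b j\<bar>) < \<eta> / 2 * \<rho>"
    using small_step[of "{()}" "\<lambda>_. 0" "\<lambda>_. \<eta> / 2 * \<rho>" "\<lambda>_. R * \<bar>b j\<bar>"] \<eta>(1) \<rho>(1) by auto
  define \<delta> where "\<delta> = min \<delta>1 (min \<delta>2 \<delta>3)"
  have \<delta>: "\<delta> > 0" "\<delta> \<le> \<delta>1" "\<delta> \<le> \<delta>2" "\<delta> \<le> \<delta>3"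
    using \<delta>1 \<delta>2 \<delta>3 by (auto simp: \<delta>_def)
  show ?thesis
  proof (rule exI[of _ \<eta>], rule exI[of _ \<delta>], rule exI[of _ \<rho>], fold h_def, intro conjI ballI impI)
    show "h \<bullet> w + \<delta> * (b j - a j \<bullet> w) < 0" if "w \<in> Z" for w
    proof -
      have "\<delta> * (b j - a j \<bullet> w) \<le> \<delta>1 * \<bar>b j - a j \<bullet> w\<bar>"
        using \<delta> abs_ge_self[of "b j - a j \<bullet> w"]
        by (intro order_trans[OF mult_left_mono mult_right_mono]) auto
      then show ?thesis using \<delta>1(2)[OF that] by linarith
    qed
    show "norm x \<le> \<rho>" if x: "x \<in> A" "\<forall>k\<in>V. a k \<bullet> x \<le> 0" "0 \<le> a i \<bullet> x"
      "h \<bullet> x \<le> \<delta> * (b j - a j \<bullet> x)" for x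
    proof -
      have "(\<Sum>k\<in>V. \<bar>a k \<bullet> x\<bar>) = - (?s \<bullet> x)"
        using x(2) by (simp add: inner_sum_left flip: sum_negf)
      then have "norm x \<le> R * - (?s \<bullet> x)"
        using R x(1) by fastforce
      then have "\<eta> * norm x \<le> \<eta> * (R * - (?s \<bullet> x))"
        using \<eta>(1) by (intro mult_left_mono) auto
      also have "\<dots> = R * (h \<bullet> x - a i \<bullet> x)"
        by (simp add: h_def inner_diff_left)
      also have "\<dots> \<le> R * (\<delta> * (b j - a j \<bullet> x))"
        using x(3,4) \<open>R > 0\<close> by (intro mult_left_mono) auto
      also have "\<dots> \<le> R * (\<delta> * (\<bar>b j\<bar> + norm (a j) * norm x))"
        using Cauchy_Schwarz_ineq2[of "a j" x] \<open>R > 0\<close> \<delta>(1) by (intro mult_left_mono) auto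
      also have "\<dots> = \<delta> * (R * \<bar>b j\<bar>) + \<delta> * (R * norm (a j)) * norm x"
        by (simp add: algebra_simps)
      also have "\<dots> \<le> \<delta>3 * (R * \<bar>b j\<bar>) + \<delta>2 * (R * norm (a j)) * norm x"
        using \<delta> \<open>R > 0\<close> by (intro add_mono mult_right_mono) auto
      also have "\<dots> \<le> \<eta> / 2 * \<rho> + \<eta> / 2 * norm x"
        using \<delta>2(2) \<delta>3(2) by (intro add_mono mult_right_mono) auto
      finally have "\<eta> / 2 * norm x \<le> \<eta> / 2 * \<rho>"
        by simp
      then show ?thesis
        using \<eta>(1) by simp
    qed
  qed (use \<delta> \<rho> in auto)
qed

lemma spindle_wedge_at_zero:
  fixes P :: "'a::euclidean_space set"
  assumes P: "spindle P 0 v" "aff_dim P = int d" and d: "d < DIM('a)"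
    and many: "d < card {F \<in> polytope_facets P. 0 \<in> F}"
  shows "\<exists>W. spindle W 0 v \<and> aff_dim W = int (Suc d) \<and>
    card (polytope_facets W) = Suc (card (polytope_facets P)) \<and>
    graph_dist P 0 v + 1 \<le> graph_dist W 0 v"
proof -
  let ?I = "polytope_facets P"
  obtain A a b where A: "subspace A" "dim A = d" and fin: "finite ?I"
    and aA: "\<And>F. F \<in> ?I \<Longrightarrow> a F \<in> A"
    and mem: "\<And>F x. F \<in> ?I \<Longrightarrow> x \<in> P \<Longrightarrow> x \<in> F \<longleftrightarrow> a F \<bullet> x = b F"
    and cell: "P = cell A ?I a b"
    and interior: "\<exists>p\<in>A. \<forall>F\<in>?I. a F \<bullet> p < b F"
    and irredundant: "\<And>F. F \<in> ?I \<Longrightarrow> \<exists>p\<in>A. a F \<bullet> p = b F \<and> (\<forall>G\<in>?I - {F}. a G \<bullet> p < b G)"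
    using spindle_facet_representation[OF P] by metis
  have poly: "polytope P" and ext: "0 extreme_point_of P" "v extreme_point_of P" and "v \<noteq> 0"
    and facet: "\<And>F. F \<in> ?I \<Longrightarrow> (0 \<in> F) \<noteq> (v \<in> F)"
    using P(1) by (auto simp: spindle_def polytope_vertices_def)
  then have in_P: "0 \<in> P" "v \<in> P"
    by (auto simp: extreme_point_of_def)
  have zero_mem: "0 \<in> F \<longleftrightarrow> b F = 0" if "F \<in> ?I" for F
    using mem[OF that in_P(1)] by auto
  have b_nonneg: "0 \<le> b F" if "F \<in> ?I" for F
  proof -
    have "0 \<in> cell A ?I a b" using in_P(1) cell by simp
    then show ?thesis using that by (simp add: cell_def)
  qed
  let ?U = "{F \<in> ?I. b F = 0}"
  have U: "{F \<in> ?I. 0 \<in> F} = ?U"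
    using zero_mem by blast
  have "0 extreme_point_of cell A ?I a b"
    using ext(1) cell by simp
  then have "span (a ` {F \<in> ?I. a F \<bullet> 0 = b F}) = A"
    by (intro span_normals_vertex A(1) fin aA)
  then have "span (a ` ?U) = A"
    by (simp add: eq_commute[of 0])
  then obtain i where i: "i \<in> ?U" "span (a ` (?U - {i})) = A"
    using exists_redundant_normal[of ?U a A] fin many A(2) U by auto
  let ?V = "{F \<in> ?I - {i}. b F = 0}"
  have V: "?U - {i} = ?V" by blast
  then have spanV: "span (a ` ?V) = A"
    using i(2) by simp
  \<comment> \<open>If no constraint were tight at v, uniqueness of the vertex would give 0 = v. The
    wedge is taken over such a facet j, which misses 0 and therefore has
    \<open>b j > 0\<close>.\<close>
  have "\<exists>j\<in>?I. a j \<bullet> v = b j"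
  proof (rule ccontr)
    assume *: "\<not> ?thesis"
    have ext_cell: "v extreme_point_of cell A ?I a b"
      using ext(2) cell by simp
    have "0 = v"
      by (rule vertex_cell_unique[OF A(1) fin ext_cell subspace_0[OF A(1)]]) (use * in blast)
    then show False using \<open>v \<noteq> 0\<close> by simp
  qed
  then obtain j where j: "j \<in> ?I" "a j \<bullet> v = b j" ..
  then have "b j > 0"
    using facet[OF j(1)] mem[OF j(1) in_P(2)] zero_mem[OF j(1)] b_nonneg[OF j(1)] by auto
  have "finite ?V"
    using fin by simp
  then obtain R where R: "R > 0" "\<forall>x\<in>A. norm x \<le> R * (\<Sum>k\<in>?V. \<bar>a k \<bullet> x\<bar>)"
    using norm_le_sum_inner_spanning[OF _ spanV] by blast
  let ?Z = "{w. w extreme_point_of P \<and> a i \<bullet> w < 0}"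
  have finZ: "finite ?Z"
    using finite_polyhedron_extreme_points[OF polytope_imp_polyhedron[OF poly]]
    by (rule rev_finite_subset) blast
  have "\<forall>w\<in>?Z. a i \<bullet> w < 0"
    by simp
  with fin \<open>finite ?V\<close> finZ R have "\<exists>\<eta> \<delta> \<rho> :: real. \<delta> > 0 \<and>
    (\<forall>w\<in>?Z. (a i - \<eta> *\<^sub>R (\<Sum>k\<in>?V. a k)) \<bullet> w + \<delta> * (b j - a j \<bullet> w) < 0) \<and>
    (\<forall>x\<in>A. (\<forall>k\<in>?V. a k \<bullet> x \<le> 0) \<longrightarrow> 0 \<le> a i \<bullet> x \<longrightarrow>
       (a i - \<eta> *\<^sub>R (\<Sum>k\<in>?V. a k)) \<bullet> x \<le> \<delta> * (b j - a j \<bullet> x) \<longrightarrow> norm x \<le> \<rho>) \<and>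
    (\<forall>k\<in>?I. 0 < b k \<longrightarrow> norm (a k) * \<rho> < b k)"
    by (rule tilt_parameters)
  then obtain \<eta> \<delta> \<rho> where \<delta>: "\<delta> > 0"
    and below: "\<forall>w\<in>?Z. (a i - \<eta> *\<^sub>R (\<Sum>k\<in>?V. a k)) \<bullet> w + \<delta> * (b j - a j \<bullet> w) < 0"
    and near: "\<forall>x\<in>A. (\<forall>k\<in>?V. a k \<bullet> x \<le> 0) \<longrightarrow> 0 \<le> a i \<bullet> x \<longrightarrow>
       (a i - \<eta> *\<^sub>R (\<Sum>k\<in>?V. a k)) \<bullet> x \<le> \<delta> * (b j - a j \<bullet> x) \<longrightarrow> norm x \<le> \<rho>"
    and \<rho>: "\<forall>k\<in>?I. 0 < b k \<longrightarrow> norm (a k) * \<rho> < b k"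
    by (elim exE conjE) (rule that)
  \<comment> \<open>Here the room for an extra dimension is used: d is below the dimension of the
    type, so some direction is orthogonal to A.\<close>
  obtain e where e: "e \<noteq> 0" "\<And>x. x \<in> span A \<Longrightarrow> orthogonal e x"
    using orthogonal_to_subspace_exists[of A] A(2) d by auto
  let ?h = "a i - \<eta> *\<^sub>R (\<Sum>k\<in>?V. a k)"
  interpret W: wedge A ?I a b i j v "sgn e" ?h \<delta> \<rho>
  proof
    show "?h \<in> A"
      using aA i A(1) by (intro subspace_diff subspace_scale subspace_sum) auto
    show "v extreme_point_of cell A ?I a b" "bounded (cell A ?I a b)"
      using ext poly cell polytope_imp_bounded by auto
    show "b k = 0 \<longleftrightarrow> a k \<bullet> v \<noteq> b k" if "k \<in> ?I" for k
      using facet[OF that] zero_mem[OF that] mem[OF that in_P(2)] by blast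
    show "sgn e \<bullet> x = 0" if "x \<in> A" for x
      using e(2)[of x] that by (simp add: sgn_div_norm orthogonal_def span_base)
    show "?h \<bullet> w + \<delta> * (b j - a j \<bullet> w) < 0" if "w extreme_point_of cell A ?I a b" "a i \<bullet> w < 0" for w
      using that below[rule_format, of w] unfolding cell[symmetric] by blast
    show "norm (a k) * \<rho> < b k" if "k \<in> ?I" "0 < b k" for k
      using \<rho> that by blast
    show "norm x \<le> \<rho>" if "x \<in> A" "\<And>k. k \<in> ?I - {i} \<Longrightarrow> b k = 0 \<Longrightarrow> a k \<bullet> x \<le> 0" "0 \<le> a i \<bullet> x"
      "?h \<bullet> x \<le> \<delta> * (b j - a j \<bullet> x)" for x
      using near[rule_format, OF that(1) _ that(3,4)] that(2) by blast
    show "norm (sgn e) = 1"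
      using e(1) by (simp add: norm_sgn)
    show "i \<in> ?I" "b i = 0"
      using i(1) by auto
  qed (fact A(1) aA fin j(1) \<open>b j > 0\<close> interior irredundant spanV b_nonneg \<delta>)+
  have "graph_dist P 0 v + 1 \<le> graph_dist W.W 0 v"
    using W.graph_dist_W cell by simp
  then show ?thesis
    using W.spindle_W W.aff_dim_W W.facets_W(3) A(2) by (intro exI[of _ W.W]) simp
qed

section \<open>Counting facets and raising the dimension\<close>

text \<open>The normals of the facets through a vertex span the d-dimensional direction space. The
  copy puts the apex at 0, where this can be read off.\<close>

lemma card_facets_at_apex:
  fixes P :: "'a::euclidean_space set"
  assumes P: "spindle P u v" "aff_dim P = int d"
  shows "d \<le> card {F \<in> polytope_facets P. u \<in> F}"
proof -
  have "d \<le> DIM('a)"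
    using aff_dim_le_DIM[of P] P(2) by simp
  then obtain Q :: "'a set" and w where Q: "spindle Q 0 w" "aff_dim Q = int d"
    "card {F \<in> polytope_facets Q. 0 \<in> F} = card {F \<in> polytope_facets P. u \<in> F}"
    by (rule spindle_affine_copy[OF P])
  let ?I = "polytope_facets Q"
  obtain A a b where A: "subspace A" "dim A = d" and fin: "finite ?I"
    and aA: "\<And>F. F \<in> ?I \<Longrightarrow> a F \<in> A"
    and mem: "\<And>F x. F \<in> ?I \<Longrightarrow> x \<in> Q \<Longrightarrow> x \<in> F \<longleftrightarrow> a F \<bullet> x = b F"
    and cell: "Q = cell A ?I a b"
    using spindle_facet_representation[OF Q(1,2)] by metis
  have ext: "0 extreme_point_of Q"
    using Q(1) by (auto simp: spindle_def polytope_vertices_def)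
  then have "0 \<in> Q"
    by (simp add: extreme_point_of_def)
  have "0 extreme_point_of cell A ?I a b"
    using ext cell by simp
  then have "span (a ` {F \<in> ?I. a F \<bullet> 0 = b F}) = A"
    by (intro span_normals_vertex A(1) fin aA)
  moreover have "{F \<in> ?I. a F \<bullet> 0 = b F} = {F \<in> ?I. 0 \<in> F}"
    using mem \<open>0 \<in> Q\<close> by blast
  ultimately have "span (a ` {F \<in> ?I. 0 \<in> F}) = A"
    by (simp only:)
  then have "d = dim (a ` {F \<in> ?I. 0 \<in> F})"
    using A(2) by (metis dim_span)
  also have "\<dots> \<le> card (a ` {F \<in> ?I. 0 \<in> F})"
    using fin by (intro dim_le_card' ) auto
  also have "\<dots> \<le> card {F \<in> ?I. 0 \<in> F}"
    using fin by (intro card_image_le) auto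
  finally show ?thesis
    using Q(3) by simp
qed

lemma card_facets_spindle:
  assumes "spindle P u v"
  shows "card (polytope_facets P) =
    card {F \<in> polytope_facets P. u \<in> F} + card {F \<in> polytope_facets P. v \<in> F}"
proof -
  have "finite (polytope_facets P)"
    using assms by (auto simp: polytope_facets_def spindle_def finite_polytope_facets)
  moreover have "polytope_facets P = {F \<in> polytope_facets P. u \<in> F} \<union> {F \<in> polytope_facets P. v \<in> F}"
    "{F \<in> polytope_facets P. u \<in> F} \<inter> {F \<in> polytope_facets P. v \<in> F} = {}"
    using assms by (auto simp: spindle_def)
  ultimately show ?thesis
    by (metis (no_types, lifting) card_Un_disjoint finite_Un)
qed

lemma spindle_wedge:
  fixes P :: "'a::euclidean_space set"
  assumes P: "spindle P u v" "aff_dim P = int d" and d: "d < DIM('a)"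
    and n: "2 * d < card (polytope_facets P)"
  shows "\<exists>(Q :: 'a set) u' v'. spindle Q u' v' \<and> aff_dim Q = int (Suc d) \<and>
    card (polytope_facets Q) = Suc (card (polytope_facets P)) \<and>
    graph_dist P u v + 1 \<le> graph_dist Q u' v'"
proof -
  have *: "\<exists>(Q :: 'a set) u' v'. spindle Q u' v' \<and> aff_dim Q = int (Suc d) \<and>
    card (polytope_facets Q) = Suc (card (polytope_facets P)) \<and>
    graph_dist P u v + 1 \<le> graph_dist Q u' v'"
    if P: "spindle P u v" and many: "d < card {F \<in> polytope_facets P. u \<in> F}" for u v
  proof -
    obtain Q :: "'a set" and w where Q: "spindle Q 0 w" "aff_dim Q = int d"
      "card (polytope_facets Q) = card (polytope_facets P)"
      "card {F \<in> polytope_facets Q. 0 \<in> F} = card {F \<in> polytope_facets P. u \<in> F}"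
      "graph_dist P u v \<le> graph_dist Q 0 w"
      by (rule spindle_affine_copy[OF P assms(2) less_imp_le[OF d]])
    obtain W where W: "spindle W 0 w" "aff_dim W = int (Suc d)"
      "card (polytope_facets W) = Suc (card (polytope_facets Q))"
      "graph_dist Q 0 w + 1 \<le> graph_dist W 0 w"
      using spindle_wedge_at_zero[OF Q(1,2) d] many Q(4) by auto
    have "graph_dist P u v + 1 \<le> graph_dist W 0 w"
      using add_right_mono[OF Q(5), of 1] W(4) by (rule order_trans)
    then show ?thesis
      using W Q(3) by (intro exI[of _ W] exI[of _ 0] exI[of _ w]) simp
  qed
  have "d < card {F \<in> polytope_facets P. u \<in> F} \<or> d < card {F \<in> polytope_facets P. v \<in> F}"
    using card_facets_spindle[OF P(1)] n by linarith
  then show ?thesis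
    using *[OF P(1)] *[OF P(1)[unfolded spindle_commute[of P u v]]] graph_dist_commute[of P u v] by auto
qed

text \<open>m is the excess of the number of facets over 2 d. A wedge adds one facet and raises 2 d
  by two, so m drops by one while the distance gains at least one.\<close>

lemma spindle_iterated_wedge:
  fixes P :: "'a::euclidean_space set"
  assumes "spindle P u v" "aff_dim P = int d" "card (polytope_facets P) = 2 * d + m" "d + m \<le> DIM('a)"
  shows "\<exists>(Q :: 'a set) u' v'. spindle Q u' v' \<and> aff_dim Q = int (d + m) \<and>
    card (polytope_facets Q) = 2 * (d + m) \<and> graph_dist P u v + enat m \<le> graph_dist Q u' v'"
  using assms
proof (induction m arbitrary: P u v d)
  case 0
  then show ?case
    by (intro exI[of _ P] exI[of _ u] exI[of _ v]) (simp flip: zero_enat_def)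
next
  case (Suc m)
  then obtain Q :: "'a set" and u' v' where Q: "spindle Q u' v'" "aff_dim Q = int (Suc d)"
    "card (polytope_facets Q) = Suc (card (polytope_facets P))"
    "graph_dist P u v + 1 \<le> graph_dist Q u' v'"
    using spindle_wedge[of P u v d] by auto
  obtain Q' :: "'a set" and u'' v'' where Q': "spindle Q' u'' v''" "aff_dim Q' = int (Suc d + m)"
    "card (polytope_facets Q') = 2 * (Suc d + m)" "graph_dist Q u' v' + enat m \<le> graph_dist Q' u'' v''"
    using Suc.IH[OF Q(1,2)] Q(3) Suc.prems(3,4) by auto
  have "graph_dist P u v + enat (Suc m) = (graph_dist P u v + 1) + enat m"
    by (simp add: add.assoc one_enat_def)
  also have "\<dots> \<le> graph_dist Q u' v' + enat m"
    by (rule add_right_mono[OF Q(4)])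
  finally have "graph_dist P u v + enat (Suc m) \<le> graph_dist Q' u'' v''"
    using Q'(4) by (rule order_trans)
  then show ?case
    using Q' by (intro exI[of _ Q'] exI[of _ u''] exI[of _ v'']) simp
qed

theorem theorem1p5:
  fixes P :: "'a::euclidean_space set" and u v :: 'a and d n l :: nat
  assumes "spindle P u v"
    and "aff_dim P = int d"
    and "card (polytope_facets P) = n"
    and "spindle_length P u v = enat l"
    and "n - d \<le> DIM('b::euclidean_space)"
  shows "\<exists>(P' :: 'b set) u' v'.
           spindle P' u' v' \<and>
           aff_dim P' = int n - int d \<and>
           card (polytope_facets P') = 2 * n - 2 * d \<and>
           spindle_length P' u' v' \<ge> enat (l + n - 2 * d) \<and>
           (l > d \<longrightarrow>
              combinatorial_diameter P' > enat (n - d) \<and>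
              \<not> d_step_conjecture TYPE('b) \<and>
              \<not> hirsch_conjecture TYPE('b))"
proof -
  \<comment> \<open>Each apex lies on at least d facets, and no facet contains both. Hence none of
    the subtractions of natural numbers truncates.\<close>
  have n: "2 * d \<le> n"
    using card_facets_at_apex[OF assms(1,2)] card_facets_spindle[OF assms(1)] assms(3)
      card_facets_at_apex[OF assms(1)[unfolded spindle_commute[of P u v]] assms(2)] by linarith
  then have "d \<le> DIM('b)"
    using assms(5) by simp
  \<comment> \<open>All wedges are built inside \<open>'b\<close>, which has room for the final
    dimension n - d, so P is copied there before the first one.\<close>
  obtain Q :: "'b set" and w where Q: "spindle Q 0 w" "aff_dim Q = int d"
    "card (polytope_facets Q) = card (polytope_facets P)"
    "card {F \<in> polytope_facets Q. 0 \<in> F} = card {F \<in> polytope_facets P. u \<in> F}"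
    "graph_dist P u v \<le> graph_dist Q 0 w"
    by (rule spindle_affine_copy[OF assms(1,2) \<open>d \<le> DIM('b)\<close>])
  have "card (polytope_facets Q) = 2 * d + (n - 2 * d)" "d + (n - 2 * d) \<le> DIM('b)"
    using Q(3) n assms(3,5) by simp_all
  then obtain P' :: "'b set" and u' v' where P': "spindle P' u' v'" "aff_dim P' = int (d + (n - 2 * d))"
    "card (polytope_facets P') = 2 * (d + (n - 2 * d))"
    "graph_dist Q 0 w + enat (n - 2 * d) \<le> graph_dist P' u' v'"
    using spindle_iterated_wedge[OF Q(1,2)] by blast
  have dim: "aff_dim P' = int (n - d)" and card: "card (polytope_facets P') = 2 * (n - d)"
    using P'(2,3) n by simp_all
  have "enat (l + n - 2 * d) = graph_dist P u v + enat (n - 2 * d)"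
    using assms(4) n by (simp add: spindle_length_def)
  also have "\<dots> \<le> graph_dist Q 0 w + enat (n - 2 * d)"
    by (rule add_right_mono[OF Q(5)])
  finally have len: "enat (l + n - 2 * d) \<le> graph_dist P' u' v'"
    using P'(4) by (rule order_trans)
  have poly: "polytope P'" and vert: "u' \<in> polytope_vertices P'" "v' \<in> polytope_vertices P'"
    using P'(1) by (auto simp: spindle_def)
  have "combinatorial_diameter P' > enat (n - d) \<and> \<not> d_step_conjecture TYPE('b) \<and>
      \<not> hirsch_conjecture TYPE('b)" if "l > d"
  proof (intro conjI)
    have "enat (n - d) < enat (l + n - 2 * d)"
      using that n by simp
    also have "\<dots> \<le> graph_dist P' u' v'"
      by (rule len)
    also have "\<dots> \<le> combinatorial_diameter P'"
      unfolding combinatorial_diameter_def using vert by (intro SUP_upper2[OF vert(1)] SUP_upper)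
    finally show diam: "combinatorial_diameter P' > enat (n - d)" .
    show "\<not> d_step_conjecture TYPE('b)"
      unfolding d_step_conjecture_def using poly dim card diam by (meson not_le)
    show "\<not> hirsch_conjecture TYPE('b)"
    proof
      assume "hirsch_conjecture TYPE('b)"
      \<comment> \<open>With 2 (n - d) facets in dimension n - d, the Hirsch bound is again n -
        d.\<close>
      then have "combinatorial_diameter P' \<le> enat (2 * (n - d) - (n - d))"
        unfolding hirsch_conjecture_def using poly dim card by blast
      then show False using diam by (simp add: not_le[symmetric])
    qed
  qed
  then show ?thesis
    using P'(1) dim card len n
    by (intro exI[of _ P'] exI[of _ u'] exI[of _ v']) (auto simp: spindle_length_def of_nat_diff)
qed

end
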